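(* Let $(\Omega,\Sigma,\mu)$ be a $\sigma$-finite measure space, let $\phi\in L^\infty(\Omega^2)$ and let $1\le p<\infty$. The following are equivalent: (i) $T_\phi$ is a bounded Schur multiplier on $S^p(L^2(\Omega))$ and the resulting operator $T_\phi\colon S^p(L^2(\Omega))\to S^p(L^2(\Omega))$ is separating; (ii) there exist $c\in\mathbb{C}$ and unitaries $\alpha,\beta\in L^\infty(\Omega)$ (i.e. $|\alpha|=|\beta|=1$ a.e.) such that $\phi(s,t)=c\,\alpha(s)\beta(t)$ for almost every $(s,t)\in\Omega^2$; (iii) there exist $c\in\mathbb{C}$ and unitaries $\alpha,\beta\in L^\infty(\Omega)$ such that $T_\phi(x)=c\,\mathrm{Mult}_\alpha\circ x\circ\mathrm{Mult}_\beta$ for all $x\in S^2(L^2(\Omega))$.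
   Context: For $f\in L^2(\Omega^2)$, $S_f$ is the operator on $L^2(\Omega)$ given by $[S_f(h)](s)=\int_\Omega f(s,t)h(t)\,d\mu(t)$; $f\mapsto S_f$ is a unitary from $L^2(\Omega^2)$ onto the Hilbert–Schmidt class $S^2(L^2(\Omega))$. For $\phi\in L^\infty(\Omega^2)$, the Schur multiplier $T_\phi$ on $S^2(L^2(\Omega))$ is $T_\phi(S_f)=S_{\phi f}$. For $1\le p<\infty$, $T_\phi$ is a bounded Schur multiplier on the Schatten class $S^p(L^2(\Omega))$ if its restriction to $S^p\cap S^2$ extends to a bounded operator on $S^p(L^2(\Omega))$. For $\alpha\in L^\infty(\Omega)$, $\mathrm{Mult}_\alpha$ is the multiplication operator $h\mapsto\alpha h$ on $L^2(\Omega)$. Operators $a,b$ are disjoint if $a^*b=ab^*=0$; a bounded operator on $S^p$ is separating if it maps disjoint pairs to disjoint pairs. *)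

theory Defs
  imports "HOL-Analysis.Analysis"
begin

(* L^2(Omega): square-integrable measurable complex functions; elements are
   identified up to a.e. equality (all notions below respect this). *)
definition L2 :: "'a measure \<Rightarrow> ('a \<Rightarrow> complex) set" where
  "L2 M = {h. h \<in> borel_measurable M \<and> integrable M (\<lambda>x. (cmod (h x))^2)}"

definition l2_inner :: "'a measure \<Rightarrow> ('a \<Rightarrow> complex) \<Rightarrow> ('a \<Rightarrow> complex) \<Rightarrow> complex" where
  "l2_inner M h g = (\<integral>x. h x * cnj (g x) \<partial>M)"

definition l2_norm :: "'a measure \<Rightarrow> ('a \<Rightarrow> complex) \<Rightarrow> real" where
  "l2_norm M h = sqrt (\<integral>x. (cmod (h x))^2 \<partial>M)"

(* operators on L^2(Omega), represented by their action on representatives *)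
type_synonym 'a op = "('a \<Rightarrow> complex) \<Rightarrow> ('a \<Rightarrow> complex)"

definition op_eq :: "'a measure \<Rightarrow> 'a op \<Rightarrow> 'a op \<Rightarrow> bool" where
  "op_eq M T U \<longleftrightarrow> (\<forall>h\<in>L2 M. AE x in M. T h x = U h x)"

definition bounded_op :: "'a measure \<Rightarrow> 'a op \<Rightarrow> bool" where
  "bounded_op M T \<longleftrightarrow>
     (\<forall>h\<in>L2 M. T h \<in> L2 M) \<and>
     (\<forall>h\<in>L2 M. \<forall>g\<in>L2 M. (AE x in M. h x = g x) \<longrightarrow> (AE x in M. T h x = T g x)) \<and>
     (\<forall>h\<in>L2 M. \<forall>g\<in>L2 M. \<forall>c. AE x in M. T (\<lambda>y. h y + c * g y) x = T h x + c * T g x) \<and>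
     (\<exists>C. \<forall>h\<in>L2 M. l2_norm M (T h) \<le> C * l2_norm M h)"

definition op_norm :: "'a measure \<Rightarrow> 'a op \<Rightarrow> real" where
  "op_norm M T = Sup {l2_norm M (T h) | h. h \<in> L2 M \<and> l2_norm M h \<le> 1}"

(* n-th singular value (approximation number, indexed from 0):
   s_n(T) = inf { ||T - F|| : rank F \<le> n },
   finite-rank operators of rank \<le> n being h \<mapsto> \<Sum>i<n. <h, v_i> u_i *)
definition sing_val :: "'a measure \<Rightarrow> 'a op \<Rightarrow> nat \<Rightarrow> real" where
  "sing_val M T n = Inf {op_norm M (\<lambda>h s. T h s - (\<Sum>i<n. l2_inner M h (v i) * u i s)) | u v.
                          \<forall>i<n. u i \<in> L2 M \<and> v i \<in> L2 M}"

definition in_schatten :: "'a measure \<Rightarrow> real \<Rightarrow> 'a op \<Rightarrow> bool" where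
  "in_schatten M p T \<longleftrightarrow> bounded_op M T \<and> summable (\<lambda>n. sing_val M T n powr p)"

definition schatten_norm :: "'a measure \<Rightarrow> real \<Rightarrow> 'a op \<Rightarrow> real" where
  "schatten_norm M p T = (\<Sum>n. sing_val M T n powr p) powr (1 / p)"

definition kernel_op :: "'a measure \<Rightarrow> ('a \<times> 'a \<Rightarrow> complex) \<Rightarrow> 'a op" where
  "kernel_op M f h = (\<lambda>s. \<integral>t. f (s, t) * h t \<partial>M)"

definition op_adjoint :: "'a measure \<Rightarrow> 'a op \<Rightarrow> 'a op \<Rightarrow> bool" where
  "op_adjoint M T T' \<longleftrightarrow> bounded_op M T' \<and>
     (\<forall>h\<in>L2 M. \<forall>g\<in>L2 M. l2_inner M (T h) g = l2_inner M h (T' g))"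

definition op_disjoint :: "'a measure \<Rightarrow> 'a op \<Rightarrow> 'a op \<Rightarrow> bool" where
  "op_disjoint M a b \<longleftrightarrow> (\<exists>a' b'. op_adjoint M a a' \<and> op_adjoint M b b' \<and>
      op_eq M (\<lambda>h. a' (b h)) (\<lambda>h s. 0) \<and> op_eq M (\<lambda>h. a (b' h)) (\<lambda>h s. 0))"

(* E is a bounded (linear) operator on S^p(L^2(Omega)) extending the Schur multiplier
   T_phi restricted to S^p \<inter> S^2, i.e. E(S_f) = S_{phi f} whenever S_f \<in> S^p *)
definition schur_bounded_ext :: "'a measure \<Rightarrow> real \<Rightarrow> ('a \<times> 'a \<Rightarrow> complex) \<Rightarrow> ('a op \<Rightarrow> 'a op) \<Rightarrow> bool" where
  "schur_bounded_ext M p \<phi> E \<longleftrightarrow>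
     (\<forall>x. in_schatten M p x \<longrightarrow> in_schatten M p (E x)) \<and>
     (\<forall>x y. in_schatten M p x \<and> in_schatten M p y \<and> op_eq M x y \<longrightarrow> op_eq M (E x) (E y)) \<and>
     (\<forall>x y c. in_schatten M p x \<and> in_schatten M p y \<longrightarrow>
        op_eq M (E (\<lambda>h s. x h s + c * y h s)) (\<lambda>h s. E x h s + c * E y h s)) \<and>
     (\<exists>C. \<forall>x. in_schatten M p x \<longrightarrow> schatten_norm M p (E x) \<le> C * schatten_norm M p x) \<and>
     (\<forall>f. f \<in> L2 (M \<Otimes>\<^sub>M M) \<and> in_schatten M p (kernel_op M f) \<longrightarrow>
        op_eq M (E (kernel_op M f)) (kernel_op M (\<lambda>z. \<phi> z * f z)))"

definition separating :: "'a measure \<Rightarrow> real \<Rightarrow> ('a op \<Rightarrow> 'a op) \<Rightarrow> bool" where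
  "separating M p E \<longleftrightarrow> (\<forall>a b. in_schatten M p a \<and> in_schatten M p b \<and> op_disjoint M a b
                              \<longrightarrow> op_disjoint M (E a) (E b))"

definition unitary_fn :: "'a measure \<Rightarrow> ('a \<Rightarrow> complex) \<Rightarrow> bool" where
  "unitary_fn M \<alpha> \<longleftrightarrow> \<alpha> \<in> borel_measurable M \<and> (AE x in M. cmod (\<alpha> x) = 1)"

end

theory Submission
  imports Defs
begin

text \<open>
  For (i) implies (ii), fix a strictly positive integrable weight \<open>w\<close>, put \<open>g = sqrt w\<close> and
  \<open>N = w M\<close>, and for a measurable set \<open>A\<close> let \<open>k\<close> be the \<open>N\<close>-mean-zero function
  \<open>N(\<Omega>) 1\<^sub>A - N(A)\<close>. The rank-one operators with kernels \<open>g \<otimes> g\<close> and \<open>gk \<otimes> gk\<close> are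
  disjoint, so their images, which have kernels \<open>\<phi> (g \<otimes> g)\<close> and \<open>\<phi> (gk \<otimes> gk)\<close>, are disjoint too.
  Testing this on \<open>g 1\<^sub>C\<close> and \<open>g 1\<^sub>D / k\<close> shows that \<open>P\<^sub>C cnj P\<^sub>D\<close>, where
  \<open>P\<^sub>C(s) = \<integral>\<^sub>C \<phi>(s,t) dN(t)\<close>, is orthogonal to \<open>k\<close> for every \<open>A\<close> and hence a.e. constant.
  If some \<open>P\<^sub>C\<close> does not vanish, its phase \<open>\<alpha>\<close> therefore satisfies \<open>P\<^sub>D = b\<^sub>D \<alpha>\<close> for all \<open>D\<close>,
  which forces \<open>\<phi>(s,t) = \<alpha>(s) \<beta>(t)\<close> a.e. The second half of disjointness gives the
  analogous statement for the integrals over the first variable, whence \<open>|\<beta>|\<close> is a.e. constant.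
\<close>

section \<open>Square-integrable functions and singular values\<close>

lemma borel_measurable_cnj [measurable (raw)]:
  assumes "f \<in> borel_measurable M"
  shows "(\<lambda>x. cnj (f x)) \<in> borel_measurable M"
proof -
  have "cnj \<in> borel_measurable borel"
    by (intro borel_measurable_continuous_onI linear_continuous_on bounded_linear_cnj)
  then show ?thesis
    by (rule measurable_compose[OF assms])
qed

lemma L2_measurable: "h \<in> L2 M \<Longrightarrow> h \<in> borel_measurable M"
  by (simp add: L2_def)

lemma L2_I_bound:
  assumes "h \<in> borel_measurable M" "integrable M w" "AE x in M. (cmod (h x))\<^sup>2 \<le> w x"
  shows "h \<in> L2 M"
proof -
  have "integrable M (\<lambda>x. (cmod (h x))\<^sup>2)"
    by (rule Bochner_Integration.integrable_bound[OF assms(2)])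
      (use assms(1,3) in auto)
  then show ?thesis using assms(1) by (simp add: L2_def)
qed

lemma L2_zero [simp]: "(\<lambda>x. 0) \<in> L2 M"
  by (simp add: L2_def)

lemma cmod_add_power2_le: "(cmod (a + b))\<^sup>2 \<le> 2 * (cmod a)\<^sup>2 + 2 * (cmod b)\<^sup>2"
proof -
  have "(cmod (a + b))\<^sup>2 \<le> (cmod a + cmod b)\<^sup>2"
    by (intro power_mono norm_triangle_ineq) simp
  also have "\<dots> \<le> 2 * (cmod a)\<^sup>2 + 2 * (cmod b)\<^sup>2"
    using zero_le_power2[of "cmod a - cmod b"] by (simp add: power2_eq_square algebra_simps)
  finally show ?thesis .
qed

lemma L2_add:
  assumes "h \<in> L2 M" "g \<in> L2 M"
  shows "(\<lambda>x. h x + g x) \<in> L2 M"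
  by (rule L2_I_bound[where w = "\<lambda>x. 2 * (cmod (h x))\<^sup>2 + 2 * (cmod (g x))\<^sup>2"])
    (use assms in \<open>auto simp: L2_def cmod_add_power2_le\<close>)

lemma L2_mult_bounded:
  assumes "h \<in> L2 M" "a \<in> borel_measurable M" "AE x in M. cmod (a x) \<le> C"
  shows "(\<lambda>x. a x * h x) \<in> L2 M"
proof (rule L2_I_bound[where w = "\<lambda>x. C\<^sup>2 * (cmod (h x))\<^sup>2"])
  show "AE x in M. (cmod (a x * h x))\<^sup>2 \<le> C\<^sup>2 * (cmod (h x))\<^sup>2"
    using assms(3)
    by eventually_elim (auto simp: norm_mult power_mult_distrib intro!: mult_right_mono power_mono)
qed (use assms in \<open>auto simp: L2_def\<close>)

lemma L2_scale: "h \<in> L2 M \<Longrightarrow> (\<lambda>x. c * h x) \<in> L2 M"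
  by (rule L2_mult_bounded[where C = "cmod c"]) auto

lemma L2_cnj: "h \<in> L2 M \<Longrightarrow> (\<lambda>x. cnj (h x)) \<in> L2 M"
  by (auto simp: L2_def)

lemma L2_unitary_mult: "unitary_fn M \<alpha> \<Longrightarrow> h \<in> L2 M \<Longrightarrow> (\<lambda>x. \<alpha> x * h x) \<in> L2 M"
  by (rule L2_mult_bounded[where C = 1]) (auto simp: unitary_fn_def)

lemma L2_integrable_mult:
  assumes "h \<in> L2 M" "g \<in> L2 M"
  shows "integrable M (\<lambda>x. h x * g x)"
proof (rule Bochner_Integration.integrable_bound
    [where f = "\<lambda>x. (cmod (h x))\<^sup>2 + (cmod (g x))\<^sup>2"])
  have "cmod a * cmod b \<le> (cmod a)\<^sup>2 + (cmod b)\<^sup>2" for a b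
  proof -
    have "0 \<le> cmod a * cmod b" by simp
    moreover have "2 * (cmod a * cmod b) \<le> (cmod a)\<^sup>2 + (cmod b)\<^sup>2"
      using sum_squares_bound[of "cmod a" "cmod b"] by (simp add: mult.assoc)
    ultimately show ?thesis by linarith
  qed
  then show "AE x in M. cmod (h x * g x) \<le> norm ((cmod (h x))\<^sup>2 + (cmod (g x))\<^sup>2)"
    by (auto simp: norm_mult)
qed (use assms in \<open>auto simp: L2_def\<close>)

lemma l2_norm_nonneg [simp]: "0 \<le> l2_norm M h"
  by (simp add: l2_norm_def)

lemma l2_norm_power2: "(l2_norm M h)\<^sup>2 = (\<integral>x. (cmod (h x))\<^sup>2 \<partial>M)"
  by (simp add: l2_norm_def)

lemma l2_norm_zero [simp]: "l2_norm M (\<lambda>x. 0) = 0"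
  by (simp add: l2_norm_def)

text \<open>Serves scalar multiples of a vector as well as multiplication by \<open>c\<close> times
  a function of modulus \<open>1\<close>: in each case the multiplier has constant modulus
  \<open>r\<close>.\<close>

lemma l2_norm_mult_const_modulus:
  assumes "h \<in> borel_measurable M" "a \<in> borel_measurable M" "AE x in M. cmod (a x) = r" "0 \<le> r"
  shows "l2_norm M (\<lambda>x. a x * h x) = r * l2_norm M h"
proof -
  have "(\<integral>x. (cmod (a x * h x))\<^sup>2 \<partial>M) = (\<integral>x. r\<^sup>2 * (cmod (h x))\<^sup>2 \<partial>M)"
    by (rule integral_cong_AE)
      (use assms in \<open>auto simp: norm_mult power_mult_distrib elim!: eventually_mono\<close>)
  then show ?thesis
    using assms(4) by (simp add: l2_norm_def real_sqrt_mult)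
qed

text \<open>A crude substitute for the triangle inequality. Only the boundedness of a sum of
  operators depends on it, so the factor \<open>2\<close> is harmless.\<close>

lemma l2_norm_add_power2_le:
  assumes "h \<in> L2 M" "g \<in> L2 M"
  shows "(l2_norm M (\<lambda>x. h x + g x))\<^sup>2 \<le> 2 * (l2_norm M h)\<^sup>2 + 2 * (l2_norm M g)\<^sup>2"
proof -
  have "(\<integral>x. (cmod (h x + g x))\<^sup>2 \<partial>M)
      \<le> (\<integral>x. 2 * (cmod (h x))\<^sup>2 + 2 * (cmod (g x))\<^sup>2 \<partial>M)"
    by (rule integral_mono) (use assms L2_add[OF assms] cmod_add_power2_le in \<open>auto simp: L2_def\<close>)
  also have "\<dots> = 2 * (\<integral>x. (cmod (h x))\<^sup>2 \<partial>M) + 2 * (\<integral>x. (cmod (g x))\<^sup>2 \<partial>M)"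
    using assms by (simp add: L2_def)
  finally show ?thesis by (simp add: l2_norm_power2)
qed

text \<open>The modulus of the integral is at most the integral of the product of the moduli, to
  which the inequality for nonnegative extended integrals applies.\<close>

lemma l2_inner_Cauchy_Schwarz:
  assumes "h \<in> L2 M" "g \<in> L2 M"
  shows "cmod (l2_inner M h g) \<le> l2_norm M h * l2_norm M g"
proof -
  have [measurable]: "h \<in> borel_measurable M" "g \<in> borel_measurable M"
    using assms by (auto simp: L2_def)
  have int: "integrable M (\<lambda>x. h x * cnj (g x))"
    using L2_integrable_mult[OF assms(1) L2_cnj[OF assms(2)]] .
  have nn: "(\<integral>\<^sup>+x. (ennreal (cmod (k x)))\<^sup>2 \<partial>M) = ennreal ((l2_norm M k)\<^sup>2)" if "k \<in> L2 M" for k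
    using that unfolding l2_norm_power2
    by (subst nn_integral_eq_integral[symmetric]) (auto simp: L2_def ennreal_power)
  have "(ennreal (cmod (l2_inner M h g)))\<^sup>2 \<le> (\<integral>\<^sup>+x. ennreal (cmod (h x)) * ennreal (cmod (g x)) \<partial>M)\<^sup>2"
    using integral_norm_bound_ennreal[OF int]
    by (intro power_mono) (simp_all add: l2_inner_def norm_mult ennreal_mult)
  also have "\<dots> \<le> (\<integral>\<^sup>+x. (ennreal (cmod (h x)))\<^sup>2 \<partial>M) * (\<integral>\<^sup>+x. (ennreal (cmod (g x)))\<^sup>2 \<partial>M)"
    by (rule Cauchy_Schwarz_nn_integral) auto
  also have "\<dots> = ennreal ((l2_norm M h * l2_norm M g)\<^sup>2)"
    by (simp add: nn assms power_mult_distrib ennreal_mult)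
  finally have "(cmod (l2_inner M h g))\<^sup>2 \<le> (l2_norm M h * l2_norm M g)\<^sup>2"
    by (simp add: ennreal_power)
  then show ?thesis
    by (rule power2_le_imp_le) simp
qed

lemma cnj_l2_inner: "cnj (l2_inner M h g) = l2_inner M g h"
proof -
  have "cnj (l2_inner M h g) = (\<integral>x. cnj (h x * cnj (g x)) \<partial>M)"
    unfolding l2_inner_def by (rule Bochner_Integration.integral_cnj[symmetric])
  also have "\<dots> = l2_inner M g h"
    unfolding l2_inner_def by (intro Bochner_Integration.integral_cong) simp_all
  finally show ?thesis .
qed

lemma l2_inner_cong_AE:
  assumes "h \<in> borel_measurable M" "h' \<in> borel_measurable M" "g \<in> borel_measurable M"
    "g' \<in> borel_measurable M" "AE x in M. h x = h' x" "AE x in M. g x = g' x"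
  shows "l2_inner M h g = l2_inner M h' g'"
  unfolding l2_inner_def
  by (rule integral_cong_AE) (use assms in auto)

section \<open>Bounded operators on L2 and their finite-rank perturbations\<close>

lemma op_eq_trans:
  assumes "op_eq M T U" "op_eq M U V"
  shows "op_eq M T V"
  unfolding op_eq_def
proof
  fix h assume "h \<in> L2 M"
  then have "AE s in M. T h s = U h s" "AE s in M. U h s = V h s"
    using assms by (auto simp: op_eq_def)
  then show "AE s in M. T h s = V h s" by eventually_elim simp
qed

lemma bounded_op_L2: "bounded_op M T \<Longrightarrow> h \<in> L2 M \<Longrightarrow> T h \<in> L2 M"
  by (simp add: bounded_op_def)

lemma bounded_op_cong:
  "bounded_op M T \<Longrightarrow> h \<in> L2 M \<Longrightarrow> g \<in> L2 M \<Longrightarrow> AE x in M. h x = g x \<Longrightarrow>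
    AE x in M. T h x = T g x"
  by (simp add: bounded_op_def)

lemma bounded_op_linear:
  "bounded_op M T \<Longrightarrow> h \<in> L2 M \<Longrightarrow> g \<in> L2 M \<Longrightarrow>
    AE x in M. T (\<lambda>y. h y + c * g y) x = T h x + c * T g x"
  by (simp add: bounded_op_def)

lemma bounded_op_bound:
  assumes "bounded_op M T"
  obtains C where "0 \<le> C" "\<And>h. h \<in> L2 M \<Longrightarrow> l2_norm M (T h) \<le> C * l2_norm M h"
proof -
  obtain C where C: "\<forall>h\<in>L2 M. l2_norm M (T h) \<le> C * l2_norm M h"
    using assms by (auto simp: bounded_op_def)
  show ?thesis
  proof (rule that[of "\<bar>C\<bar>"])
    fix h assume "h \<in> L2 M"
    then have "l2_norm M (T h) \<le> C * l2_norm M h" using C by blast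
    also have "\<dots> \<le> \<bar>C\<bar> * l2_norm M h" by (intro mult_right_mono) auto
    finally show "l2_norm M (T h) \<le> \<bar>C\<bar> * l2_norm M h" .
  qed simp
qed

lemma bounded_op_zero_arg:
  assumes "bounded_op M T"
  shows "AE x in M. T (\<lambda>y. 0) x = 0"
  using bounded_op_linear[OF assms L2_zero L2_zero, of 1] by simp

lemma bounded_op_scale_arg:
  assumes "bounded_op M T" "h \<in> L2 M"
  shows "AE x in M. T (\<lambda>y. c * h y) x = c * T h x"
  using bounded_op_linear[OF assms(1) L2_zero assms(2), of c] bounded_op_zero_arg[OF assms(1)]
  by eventually_elim simp

lemma l2_inner_add_left:
  assumes "h \<in> L2 M" "g \<in> L2 M" "v \<in> L2 M"
  shows "l2_inner M (\<lambda>y. h y + c * g y) v = l2_inner M h v + c * l2_inner M g v"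
  using L2_integrable_mult[OF assms(1) L2_cnj[OF assms(3)]]
    L2_integrable_mult[OF assms(2) L2_cnj[OF assms(3)]]
  by (simp add: l2_inner_def algebra_simps)

text \<open>The perturbation has norm at most the product of the norms of \<open>u\<close> and
  \<open>v\<close>, by Cauchy-Schwarz. This is the induction step for finite-rank approximants, and
  with \<open>T = 0\<close> it yields the boundedness of rank-one operators.\<close>

lemma bounded_op_diff_rank_one:
  assumes T: "bounded_op M T" and uv: "u \<in> L2 M" "v \<in> L2 M"
  shows "bounded_op M (\<lambda>h s. T h s - l2_inner M h v * u s)"
proof -
  obtain C where C: "0 \<le> C" "\<And>h. h \<in> L2 M \<Longrightarrow> l2_norm M (T h) \<le> C * l2_norm M h"
    using bounded_op_bound[OF T] by blast
  define D where "D = l2_norm M v * l2_norm M u"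
  have D: "0 \<le> D" by (simp add: D_def)
  let ?R = "\<lambda>h s. (- l2_inner M h v) * u s"
  have eq: "(\<lambda>h s. T h s - l2_inner M h v * u s) = (\<lambda>h s. T h s + ?R h s)"
    by simp
  have R: "?R h \<in> L2 M" for h
    by (rule L2_scale[OF uv(1)])
  have normR: "l2_norm M (?R h) \<le> D * l2_norm M h" if h: "h \<in> L2 M" for h
  proof -
    have "l2_norm M (?R h) = cmod (l2_inner M h v) * l2_norm M u"
      by (rule l2_norm_mult_const_modulus) (use uv in \<open>auto simp: L2_def\<close>)
    also have "\<dots> \<le> (l2_norm M h * l2_norm M v) * l2_norm M u"
      by (intro mult_right_mono l2_inner_Cauchy_Schwarz h uv) simp
    finally show ?thesis by (simp add: D_def mult_ac)
  qed
  \<comment> \<open>The constant comes from the squared inequality for a sum, with the bounds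
    \<open>C\<close> for \<open>T\<close> and \<open>D\<close> for the perturbation.\<close>
  have "l2_norm M (\<lambda>s. T h s + ?R h s) \<le> sqrt (2 * C\<^sup>2 + 2 * D\<^sup>2) * l2_norm M h"
    if h: "h \<in> L2 M" for h
  proof (rule power2_le_imp_le)
    have "(l2_norm M (\<lambda>s. T h s + ?R h s))\<^sup>2 \<le> 2 * (l2_norm M (T h))\<^sup>2 + 2 * (l2_norm M (?R h))\<^sup>2"
      by (rule l2_norm_add_power2_le[OF bounded_op_L2[OF T h] R])
    also have "\<dots> \<le> 2 * (C * l2_norm M h)\<^sup>2 + 2 * (D * l2_norm M h)\<^sup>2"
      using C(2)[OF h] normR[OF h] by (intro add_mono mult_left_mono power_mono) auto
    finally show "(l2_norm M (\<lambda>s. T h s + ?R h s))\<^sup>2 \<le> (sqrt (2 * C\<^sup>2 + 2 * D\<^sup>2) * l2_norm M h)\<^sup>2"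
      by (simp add: power_mult_distrib algebra_simps)
  qed (use C D in auto)
  moreover have "AE x in M. T (\<lambda>y. h y + c * g y) x + ?R (\<lambda>y. h y + c * g y) x
      = (T h x + ?R h x) + c * (T g x + ?R g x)" if "h \<in> L2 M" "g \<in> L2 M" for h g c
    using bounded_op_linear[OF T that, of c]
    by eventually_elim (simp add: l2_inner_add_left[OF that uv(2)] algebra_simps)
  moreover have "AE x in M. T h x + ?R h x = T g x + ?R g x"
    if "h \<in> L2 M" "g \<in> L2 M" "AE x in M. h x = g x" for h g
  proof -
    have "l2_inner M h v = l2_inner M g v"
      by (rule l2_inner_cong_AE) (use that uv in \<open>auto simp: L2_def\<close>)
    then show ?thesis using bounded_op_cong[OF T that] by simp
  qed
  ultimately show ?thesis
    unfolding eq bounded_op_def using L2_add[OF bounded_op_L2[OF T] R] by blast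
qed

text \<open>Makes every competitor in the infimum defining \<open>sing_val\<close> a bounded
  operator, so that its \<open>op_norm\<close> is a genuine supremum.\<close>

lemma bounded_op_diff_finite_rank:
  fixes n :: nat
  assumes "bounded_op M T" "\<forall>i<n. u i \<in> L2 M \<and> v i \<in> L2 M"
  shows "bounded_op M (\<lambda>h s. T h s - (\<Sum>i<n. l2_inner M h (v i) * u i s))"
  using assms(2)
proof (induction n)
  case 0
  then show ?case using assms(1) by simp
next
  case (Suc n)
  then have "bounded_op M (\<lambda>h s. (T h s - (\<Sum>i<n. l2_inner M h (v i) * u i s))
      - l2_inner M h (v n) * u n s)"
    by (intro bounded_op_diff_rank_one) auto
  then show ?case by (simp add: algebra_simps)
qed

lemma bounded_op_zero: "bounded_op M (\<lambda>h s. 0)"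
  unfolding bounded_op_def by (auto intro!: exI[of _ 0])

section \<open>Operator norms, approximation numbers and rank-one operators\<close>

lemma op_norm_upper:
  assumes "bounded_op M T" "h \<in> L2 M" "l2_norm M h \<le> 1"
  shows "l2_norm M (T h) \<le> op_norm M T"
proof -
  obtain C where C: "0 \<le> C" "\<And>h. h \<in> L2 M \<Longrightarrow> l2_norm M (T h) \<le> C * l2_norm M h"
    using bounded_op_bound[OF assms(1)] by blast
  have "l2_norm M (T h) \<le> C" if "h \<in> L2 M" "l2_norm M h \<le> 1" for h
    using C(2)[OF that(1)] mult_left_mono[OF that(2) C(1)] by simp
  then have "bdd_above {l2_norm M (T h) | h. h \<in> L2 M \<and> l2_norm M h \<le> 1}"
    by (auto simp: bdd_above_def)
  then show ?thesis
    unfolding op_norm_def by (rule cSup_upper[rotated]) (use assms in blast)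
qed

lemma op_norm_least:
  assumes "\<And>h. h \<in> L2 M \<Longrightarrow> l2_norm M h \<le> 1 \<Longrightarrow> l2_norm M (T h) \<le> B"
  shows "op_norm M T \<le> B"
  unfolding op_norm_def
proof (rule cSup_least)
  \<comment> \<open>The zero vector keeps the set nonempty, as a least upper bound on the reals
    requires.\<close>
  have "l2_norm M (T (\<lambda>x. 0)) \<in> {l2_norm M (T h) | h. h \<in> L2 M \<and> l2_norm M h \<le> 1}"
    using L2_zero l2_norm_zero by fastforce
  then show "{l2_norm M (T h) | h. h \<in> L2 M \<and> l2_norm M h \<le> 1} \<noteq> {}" by blast
qed (use assms in auto)

lemma op_norm_nonneg:
  assumes "bounded_op M T"
  shows "0 \<le> op_norm M T"
  by (rule order_trans[OF l2_norm_nonneg op_norm_upper[OF assms L2_zero]]) simp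

lemma sing_val_le:
  assumes "bounded_op M T" "\<forall>i<n. u i \<in> L2 M \<and> v i \<in> L2 M"
  shows "sing_val M T n \<le> op_norm M (\<lambda>h s. T h s - (\<Sum>i<n. l2_inner M h (v i) * u i s))"
  unfolding sing_val_def
proof (rule cInf_lower)
  show "bdd_below {op_norm M (\<lambda>h s. T h s - (\<Sum>i<n. l2_inner M h (v i) * u i s)) | u v.
      \<forall>i<n. u i \<in> L2 M \<and> v i \<in> L2 M}"
    by (rule bdd_belowI[of _ 0])
      (auto intro!: op_norm_nonneg bounded_op_diff_finite_rank[OF assms(1)])
  show "op_norm M (\<lambda>h s. T h s - (\<Sum>i<n. l2_inner M h (v i) * u i s))
    \<in> {op_norm M (\<lambda>h s. T h s - (\<Sum>i<n. l2_inner M h (v i) * u i s)) | u v.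
      \<forall>i<n. u i \<in> L2 M \<and> v i \<in> L2 M}"
    by (rule CollectI, rule exI[of _ u], rule exI[of _ v]) (simp add: assms(2))
qed

lemma sing_val_greatest:
  assumes "\<And>u v. \<forall>i<n. u i \<in> L2 M \<and> v i \<in> L2 M \<Longrightarrow>
    B \<le> op_norm M (\<lambda>h s. T h s - (\<Sum>i<n. l2_inner M h (v i) * u i s))"
  shows "B \<le> sing_val M T n"
  unfolding sing_val_def
proof (rule cInf_greatest)
  show "{op_norm M (\<lambda>h s. T h s - (\<Sum>i<n. l2_inner M h (v i) * u i s)) | u v.
      \<forall>i<n. u i \<in> L2 M \<and> v i \<in> L2 M} \<noteq> {}"
    by (simp, rule exI[of _ "\<lambda>i x. 0"], simp, rule exI[of _ "\<lambda>i x. 0"], simp)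
qed (use assms in auto)

lemma sing_val_nonneg: "bounded_op M T \<Longrightarrow> 0 \<le> sing_val M T n"
  by (rule sing_val_greatest) (intro op_norm_nonneg bounded_op_diff_finite_rank)

text \<open>A rank-one operator is its own approximant of rank at most \<open>n\<close> for every
  \<open>n \<ge> 1\<close>, so only the singular value of index \<open>0\<close> can be
  nonzero.\<close>

lemma in_schatten_rank_one:
  assumes "u \<in> L2 M" "v \<in> L2 M"
  shows "in_schatten M p (kernel_op M (\<lambda>z. u (fst z) * v (snd z)))" (is "in_schatten M p ?K")
proof -
  let ?v = "\<lambda>x. cnj (v x)"
  \<comment> \<open>The kernel pairs \<open>h\<close> with \<open>v\<close> without conjugation, so
    the vector in the inner product is the conjugate of \<open>v\<close>.\<close>
  have K: "?K = (\<lambda>h s. l2_inner M h ?v * u s)"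
    unfolding kernel_op_def l2_inner_def fun_eq_iff integral_mult_left_zero[symmetric]
    by (intro allI Bochner_Integration.integral_cong) simp_all
  have "bounded_op M (\<lambda>h s. 0 - l2_inner M h ?v * ((- 1) * u s))"
    by (intro bounded_op_diff_rank_one[OF bounded_op_zero] L2_scale L2_cnj assms)
  then have bdd: "bounded_op M ?K"
    by (simp add: K)
  have "sing_val M ?K n = 0" if "n \<ge> 1" for n
  proof (rule antisym[OF _ sing_val_nonneg[OF bdd]])
    \<comment> \<open>The vector \<open>u\<close> fills slot \<open>0\<close> and zero vectors pad
      the rest, so a sum over \<open>i<n\<close> keeps one term.\<close>
    define U where "U i = (if i = 0 then u else (\<lambda>x. 0))" for i :: nat
    have S: "(\<Sum>i<n. l2_inner M h ?v * U i s) = l2_inner M h ?v * u s" for h s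
    proof -
      have "(\<Sum>i<n. l2_inner M h ?v * U i s) = (\<Sum>i<n. if i = 0 then l2_inner M h ?v * u s else 0)"
        by (intro sum.cong) (auto simp: U_def)
      also have "\<dots> = l2_inner M h ?v * u s" using that by simp
      finally show ?thesis .
    qed
    have "sing_val M ?K n \<le> op_norm M (\<lambda>h s. ?K h s - (\<Sum>i<n. l2_inner M h ?v * U i s))"
      by (rule sing_val_le[OF bdd]) (auto simp: U_def assms L2_cnj)
    also have "\<dots> = op_norm M (\<lambda>h s. 0)"
      by (simp add: S K)
    also have "\<dots> \<le> 0" by (rule op_norm_least) simp
    finally show "sing_val M ?K n \<le> 0" .
  qed
  \<comment> \<open>Since \<open>0 powr p\<close> is \<open>0\<close>, at most one term of the
    series is nonzero.\<close>
  then have "summable (\<lambda>n. sing_val M ?K n powr p)"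
    by (intro summable_finite[of "{0}"]) auto
  then show ?thesis using bdd by (simp add: in_schatten_def)
qed

section \<open>Two-sided multiplication by unimodular functions\<close>

lemma unitary_fn_cnj: "unitary_fn M \<alpha> \<Longrightarrow> unitary_fn M (\<lambda>x. cnj (\<alpha> x))"
  by (auto simp: unitary_fn_def)

text \<open>The right-hand side of (iii), turned into a function on operators so that it can also
  serve as the extension \<open>E\<close> in (i).\<close>

definition mult_conj :: "complex \<Rightarrow> ('a \<Rightarrow> complex) \<Rightarrow> ('a \<Rightarrow> complex) \<Rightarrow> 'a op \<Rightarrow> 'a op" where
  "mult_conj c \<alpha> \<beta> x = (\<lambda>h s. c * \<alpha> s * x (\<lambda>t. \<beta> t * h t) s)"

context
  fixes M :: "'a measure" and \<alpha> \<beta> :: "'a \<Rightarrow> complex" and c :: complex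
  assumes unitary: "unitary_fn M \<alpha>" "unitary_fn M \<beta>"
begin

lemma l2_norm_unitary_scale:
  assumes "h \<in> L2 M"
  shows "l2_norm M (\<lambda>s. c * \<alpha> s * h s) = cmod c * l2_norm M h"
  by (rule l2_norm_mult_const_modulus)
    (use assms unitary in \<open>auto simp: L2_def unitary_fn_def norm_mult elim!: eventually_mono\<close>)

lemma l2_norm_unitary_mult:
  assumes "h \<in> L2 M"
  shows "l2_norm M (\<lambda>s. \<beta> s * h s) = l2_norm M h"
  using l2_norm_mult_const_modulus[of h M \<beta> 1] assms unitary by (auto simp: L2_def unitary_fn_def)

lemma bounded_op_mult_conj:
  assumes x: "bounded_op M x"
  shows "bounded_op M (mult_conj c \<alpha> \<beta> x)"
proof -
  note b = L2_unitary_mult[OF unitary(2)]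
  obtain C where C: "0 \<le> C" "\<And>h. h \<in> L2 M \<Longrightarrow> l2_norm M (x h) \<le> C * l2_norm M h"
    using bounded_op_bound[OF x] by blast
  have "mult_conj c \<alpha> \<beta> x h \<in> L2 M" if "h \<in> L2 M" for h
    unfolding mult_conj_def mult.assoc
    by (intro L2_scale L2_unitary_mult unitary bounded_op_L2[OF x] that)
  moreover have "AE s in M. mult_conj c \<alpha> \<beta> x h s = mult_conj c \<alpha> \<beta> x g s"
    if "h \<in> L2 M" "g \<in> L2 M" "AE s in M. h s = g s" for h g
  proof -
    have "AE s in M. x (\<lambda>t. \<beta> t * h t) s = x (\<lambda>t. \<beta> t * g t) s"
      by (rule bounded_op_cong[OF x b b]) (use that in auto)
    then show ?thesis by eventually_elim (simp add: mult_conj_def)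
  qed
  moreover have "AE s in M. mult_conj c \<alpha> \<beta> x (\<lambda>y. h y + d * g y) s
      = mult_conj c \<alpha> \<beta> x h s + d * mult_conj c \<alpha> \<beta> x g s" if "h \<in> L2 M" "g \<in> L2 M" for h g d
  proof -
    have eq: "(\<lambda>t. \<beta> t * (h t + d * g t)) = (\<lambda>t. \<beta> t * h t + d * (\<beta> t * g t))"
      by (simp add: algebra_simps)
    show ?thesis
      using bounded_op_linear[OF x b[OF that(1)] b[OF that(2)], of d]
      by eventually_elim (simp add: mult_conj_def eq algebra_simps)
  qed
  moreover have "l2_norm M (mult_conj c \<alpha> \<beta> x h) \<le> (cmod c * C) * l2_norm M h" if "h \<in> L2 M" for h
  proof -
    have "l2_norm M (mult_conj c \<alpha> \<beta> x h) = cmod c * l2_norm M (x (\<lambda>t. \<beta> t * h t))"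
      unfolding mult_conj_def by (intro l2_norm_unitary_scale bounded_op_L2[OF x] b that)
    also have "\<dots> \<le> cmod c * (C * l2_norm M (\<lambda>t. \<beta> t * h t))"
      by (intro mult_left_mono C b that) simp
    finally show ?thesis by (simp add: l2_norm_unitary_mult[OF that])
  qed
  ultimately show ?thesis
    unfolding bounded_op_def by blast
qed

text \<open>An approximant of \<open>x\<close> becomes one of the image when each \<open>u i\<close>
  is multiplied by \<open>c\<close> and \<alpha>, and each \<open>v i\<close> by the conjugate of
  \<beta>. The difference is then transformed in the same way as \<open>x\<close>, and its norm
  grows by at most \<open>cmod c\<close> because multiplication by \<beta> preserves the unit
  ball.\<close>

lemma sing_val_mult_conj_le:
  assumes x: "bounded_op M x"
  shows "sing_val M (mult_conj c \<alpha> \<beta> x) n \<le> cmod c * sing_val M x n"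
proof -
  note b = L2_unitary_mult[OF unitary(2)]
  let ?s = "sing_val M (mult_conj c \<alpha> \<beta> x) n"
  have le: "?s \<le> cmod c * op_norm M (\<lambda>h s. x h s - (\<Sum>i<n. l2_inner M h (v i) * u i s))"
    if uv: "\<forall>i<n. u i \<in> L2 M \<and> v i \<in> L2 M" for u v
  proof -
    let ?D = "\<lambda>h s. x h s - (\<Sum>i<n. l2_inner M h (v i) * u i s)"
    define U where "U i s = c * (\<alpha> s * u i s)" for i s
    define V where "V i s = cnj (\<beta> s) * v i s" for i s
    note D = bounded_op_diff_finite_rank[OF x uv]
    have UV: "\<forall>i<n. U i \<in> L2 M \<and> V i \<in> L2 M"
      unfolding U_def V_def using uv
      by (auto intro!: L2_scale L2_unitary_mult unitary unitary_fn_cnj)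
    have inner: "l2_inner M h (V i) = l2_inner M (\<lambda>t. \<beta> t * h t) (v i)" for h i
      by (simp add: l2_inner_def V_def mult_ac)
    have eq: "(\<lambda>s. mult_conj c \<alpha> \<beta> x h s - (\<Sum>i<n. l2_inner M h (V i) * U i s))
        = (\<lambda>s. c * \<alpha> s * ?D (\<lambda>t. \<beta> t * h t) s)" for h
      unfolding inner
      by (simp add: mult_conj_def U_def right_diff_distrib sum_distrib_left mult_ac)
    have "?s \<le> op_norm M (\<lambda>h s. mult_conj c \<alpha> \<beta> x h s - (\<Sum>i<n. l2_inner M h (V i) * U i s))"
      by (rule sing_val_le[OF bounded_op_mult_conj[OF x] UV])
    also have "\<dots> \<le> cmod c * op_norm M ?D"
    proof (rule op_norm_least)
      fix h assume h: "h \<in> L2 M" "l2_norm M h \<le> 1"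
      have "l2_norm M (\<lambda>s. c * \<alpha> s * ?D (\<lambda>t. \<beta> t * h t) s) = cmod c * l2_norm M (?D (\<lambda>t. \<beta> t * h t))"
        by (rule l2_norm_unitary_scale) (rule bounded_op_L2[OF D b[OF h(1)]])
      also have "\<dots> \<le> cmod c * op_norm M ?D"
        using h by (intro mult_left_mono op_norm_upper[OF D] b) (auto simp: l2_norm_unitary_mult)
      finally show "l2_norm M (\<lambda>s. mult_conj c \<alpha> \<beta> x h s - (\<Sum>i<n. l2_inner M h (V i) * U i s))
          \<le> cmod c * op_norm M ?D"
        unfolding eq .
    qed
    finally show ?thesis .
  qed
  show ?thesis
  \<comment> \<open>The infimum is compared after division by \<open>cmod c\<close>; for
    \<open>c = 0\<close> the approximant with all vectors zero already gives the bound
    \<open>0\<close>.\<close>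
  proof (cases "c = 0")
    case True
    then show ?thesis using le[of "\<lambda>i x. 0" "\<lambda>i x. 0"] by simp
  next
    case False
    have "?s / cmod c \<le> sing_val M x n"
    proof (rule sing_val_greatest)
      fix u v :: "nat \<Rightarrow> 'a \<Rightarrow> complex"
      assume "\<forall>i<n. u i \<in> L2 M \<and> v i \<in> L2 M"
      from le[OF this] show "?s / cmod c \<le> op_norm M (\<lambda>h s. x h s - (\<Sum>i<n. l2_inner M h (v i) * u i s))"
        using False by (simp add: field_simps)
    qed
    then show ?thesis using False by (simp add: field_simps)
  qed
qed

text \<open>Sums the termwise bound on singular values; the factor \<open>cmod c powr p\<close>
  leaves the \<open>p\<close>-th root as \<open>cmod c\<close>.\<close>

lemma in_schatten_mult_conj:
  assumes x: "in_schatten M p x" and p: "0 < p"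
  shows "in_schatten M p (mult_conj c \<alpha> \<beta> x)"
    and "schatten_norm M p (mult_conj c \<alpha> \<beta> x) \<le> cmod c * schatten_norm M p x"
proof -
  have bdd: "bounded_op M x" and sm: "summable (\<lambda>n. sing_val M x n powr p)"
    using x by (auto simp: in_schatten_def)
  let ?y = "mult_conj c \<alpha> \<beta> x"
  have le: "sing_val M ?y n powr p \<le> cmod c powr p * sing_val M x n powr p" for n
    using powr_mono2[OF less_imp_le[OF p] sing_val_nonneg[OF bounded_op_mult_conj[OF bdd]]
        sing_val_mult_conj_le[OF bdd, of n]]
    by (simp add: powr_mult sing_val_nonneg[OF bdd])
  have sm': "summable (\<lambda>n. cmod c powr p * sing_val M x n powr p)"
    using sm by (rule summable_mult)
  have smy: "summable (\<lambda>n. sing_val M ?y n powr p)"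
    by (rule summable_comparison_test[OF _ sm']) (use le in auto)
  then show "in_schatten M p ?y"
    using bounded_op_mult_conj[OF bdd] by (simp add: in_schatten_def)
  have "(\<Sum>n. sing_val M ?y n powr p) \<le> cmod c powr p * (\<Sum>n. sing_val M x n powr p)"
    using suminf_le[OF le smy sm'] suminf_mult[OF sm] by simp
  then have "schatten_norm M p ?y \<le> (cmod c powr p * (\<Sum>n. sing_val M x n powr p)) powr (1 / p)"
    unfolding schatten_norm_def using p smy by (intro powr_mono2) (auto intro: suminf_nonneg)
  also have "\<dots> = cmod c * schatten_norm M p x"
    unfolding schatten_norm_def using p
    by (subst powr_mult) (auto simp: powr_powr intro: suminf_nonneg[OF sm])
  finally show "schatten_norm M p ?y \<le> cmod c * schatten_norm M p x" .
qed

text \<open>Taking adjoints reverses the order of the factors and conjugates each of them. The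
  boundedness that \<open>op_adjoint\<close> also demands is \<open>bounded_op_mult_conj\<close> for
  the conjugated multipliers.\<close>

lemma op_adjoint_mult_conj:
  assumes adj: "op_adjoint M x x'"
    and hg: "h \<in> L2 M" "g \<in> L2 M"
  shows "l2_inner M (mult_conj c \<alpha> \<beta> x h) g
    = l2_inner M h (mult_conj (cnj c) (\<lambda>s. cnj (\<beta> s)) (\<lambda>s. cnj (\<alpha> s)) x' g)"
proof -
  have a: "(\<lambda>t. cnj (\<alpha> t) * g t) \<in> L2 M"
    by (intro L2_unitary_mult unitary_fn_cnj unitary hg)
  have "l2_inner M (mult_conj c \<alpha> \<beta> x h) g
      = c * l2_inner M (x (\<lambda>t. \<beta> t * h t)) (\<lambda>t. cnj (\<alpha> t) * g t)"
    unfolding l2_inner_def integral_mult_right_zero[symmetric]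
    by (intro Bochner_Integration.integral_cong) (simp_all add: mult_conj_def)
  also have "\<dots> = c * l2_inner M (\<lambda>t. \<beta> t * h t) (x' (\<lambda>t. cnj (\<alpha> t) * g t))"
    using adj L2_unitary_mult[OF unitary(2) hg(1)] a by (simp add: op_adjoint_def)
  also have "\<dots> = l2_inner M h (mult_conj (cnj c) (\<lambda>s. cnj (\<beta> s)) (\<lambda>s. cnj (\<alpha> s)) x' g)"
    unfolding l2_inner_def integral_mult_right_zero[symmetric]
    by (intro Bochner_Integration.integral_cong) (simp_all add: mult_conj_def)
  finally show ?thesis .
qed

end

section \<open>Kernels determined by slice integrals\<close>

text \<open>Dynkin's argument: the sets over which \<open>g\<close> integrates to \<open>0\<close>
  are closed under complements and countable disjoint unions, and rectangles form a generator stable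
  under intersection. An integrable function with vanishing integral over every measurable set is
  \<open>0\<close> a.e.\<close>

lemma AE_eq_0_of_rectangles:
  fixes g :: "'a \<times> 'b \<Rightarrow> complex"
  assumes "sigma_finite_measure M" "sigma_finite_measure N"
    and g: "integrable (M \<Otimes>\<^sub>M N) g"
    and rect: "\<And>A B. A \<in> sets M \<Longrightarrow> B \<in> sets N \<Longrightarrow> set_lebesgue_integral (M \<Otimes>\<^sub>M N) (A \<times> B) g = 0"
  shows "AE z in M \<Otimes>\<^sub>M N. g z = 0"
proof -
  interpret pair_sigma_finite M N
    using assms(1,2) by (simp add: pair_sigma_finite_def)
  let ?G = "{a \<times> b | a b. a \<in> sets M \<and> b \<in> sets N}"
  have int: "set_integrable (M \<Otimes>\<^sub>M N) C g" if "C \<in> sets (M \<Otimes>\<^sub>M N)" for C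
    using integrable_mult_indicator[OF that g] by (simp add: set_integrable_def)
  have sets: "C \<in> sets (M \<Otimes>\<^sub>M N) \<longleftrightarrow> C \<in> sigma_sets (space M \<times> space N) ?G" for C
    by (simp add: sets_pair_measure)
  have "set_lebesgue_integral (M \<Otimes>\<^sub>M N) C g = 0" if C: "C \<in> sets (M \<Otimes>\<^sub>M N)" for C
    using Int_stable_pair_measure_generator pair_measure_closed C[unfolded sets]
  proof (induction C rule: sigma_sets_induct_disjoint)
    case (basic A)
    then show ?case using rect by auto
  next
    case empty
    then show ?case by (simp add: set_lebesgue_integral_def)
  next
    case (compl A)
    let ?S = "space M \<times> space N"
    have A: "A \<in> sets (M \<Otimes>\<^sub>M N)" using compl(1) sets by simp
    have S: "?S \<in> sets (M \<Otimes>\<^sub>M N)" by auto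
    have sub: "A \<subseteq> ?S" using sets.sets_into_space[OF A] by (simp add: space_pair_measure)
    have "set_lebesgue_integral (M \<Otimes>\<^sub>M N) (A \<union> (?S - A)) g
        = set_lebesgue_integral (M \<Otimes>\<^sub>M N) A g + set_lebesgue_integral (M \<Otimes>\<^sub>M N) (?S - A) g"
      using A S by (intro set_integral_Un int) auto
    moreover have "A \<union> (?S - A) = ?S" using sub by auto
    \<comment> \<open>The whole space is itself a rectangle, so the integral over a complement is
      minus the integral over the set.\<close>
    moreover have "set_lebesgue_integral (M \<Otimes>\<^sub>M N) ?S g = 0" by (rule rect) auto
    ultimately show ?case using compl by simp
  next
    case (union A)
    have "range A \<subseteq> sets (M \<Otimes>\<^sub>M N)" using union(2) sets by auto
    then have "set_lebesgue_integral (M \<Otimes>\<^sub>M N) (\<Union>i. A i) g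
        = (\<Sum>i. set_lebesgue_integral (M \<Otimes>\<^sub>M N) (A i) g)"
      using union(1) by (intro lebesgue_integral_countable_add int) (auto simp: disjoint_family_on_def)
    then show ?case using union by simp
  qed
  then show ?thesis
    by (rule density_zero[OF g])
qed

text \<open>By Fubini the integral over a rectangle is an integral of slice integrals over its
  second side. Only one rectangle is compared at a time, so the null set in \<open>slice\<close> may
  depend on \<open>D\<close>.\<close>

lemma AE_eq_of_slice_integrals:
  fixes \<phi> \<psi> :: "'a \<times> 'b \<Rightarrow> complex"
  assumes "sigma_finite_measure M" "sigma_finite_measure N"
    and \<phi>: "integrable (M \<Otimes>\<^sub>M N) \<phi>" and \<psi>: "integrable (M \<Otimes>\<^sub>M N) \<psi>"
    and slice: "\<And>D. D \<in> sets N \<Longrightarrow>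
      AE s in M. (\<integral>t. indicator D t * \<phi> (s, t) \<partial>N) = (\<integral>t. indicator D t * \<psi> (s, t) \<partial>N)"
  shows "AE z in M \<Otimes>\<^sub>M N. \<phi> z = \<psi> z"
proof -
  interpret pair_sigma_finite M N
    using assms(1,2) by (simp add: pair_sigma_finite_def)
  have "AE z in M \<Otimes>\<^sub>M N. \<phi> z - \<psi> z = 0"
  proof (rule AE_eq_0_of_rectangles[OF assms(1,2)])
    show "integrable (M \<Otimes>\<^sub>M N) (\<lambda>z. \<phi> z - \<psi> z)" using \<phi> \<psi> by simp
    fix A B assume AB: "A \<in> sets M" "B \<in> sets N"
    have int: "integrable (M \<Otimes>\<^sub>M N) (\<lambda>z. indicator (A \<times> B) z * k z)"
      if "integrable (M \<Otimes>\<^sub>M N) k" for k :: "'a \<times> 'b \<Rightarrow> complex"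
      using integrable_mult_indicator[OF _ that, of "A \<times> B"] AB
      by (simp add: scaleR_conv_of_real of_real_indicator)
    have eq: "(\<integral>z. indicator (A \<times> B) z * k z \<partial>(M \<Otimes>\<^sub>M N))
        = (\<integral>s. indicator A s * (\<integral>t. indicator B t * k (s, t) \<partial>N) \<partial>M)"
      if "integrable (M \<Otimes>\<^sub>M N) k" for k :: "'a \<times> 'b \<Rightarrow> complex"
      unfolding integral_fst'[OF int[OF that], symmetric]
      by (simp add: indicator_times mult.assoc)
    have "(\<lambda>s. \<integral>t. indicator B t * k (s, t) \<partial>N) \<in> borel_measurable M"
      if "integrable (M \<Otimes>\<^sub>M N) k" for k :: "'a \<times> 'b \<Rightarrow> complex"
      using borel_measurable_integrable[OF that] AB by measurable
    then have "(\<integral>s. indicator A s * (\<integral>t. indicator B t * \<phi> (s, t) \<partial>N) \<partial>M)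
        = (\<integral>s. indicator A s * (\<integral>t. indicator B t * \<psi> (s, t) \<partial>N) \<partial>M)"
      using slice[OF AB(2)] \<phi> \<psi> AB by (intro integral_cong_AE) auto
    then have "(\<integral>z. indicator (A \<times> B) z * \<phi> z \<partial>(M \<Otimes>\<^sub>M N))
        = (\<integral>z. indicator (A \<times> B) z * \<psi> z \<partial>(M \<Otimes>\<^sub>M N))"
      by (simp only: eq[OF \<phi>] eq[OF \<psi>])
    then show "set_lebesgue_integral (M \<Otimes>\<^sub>M N) (A \<times> B) (\<lambda>z. \<phi> z - \<psi> z) = 0"
      using int[OF \<phi>] int[OF \<psi>]
      by (simp add: set_lebesgue_integral_def scaleR_conv_of_real of_real_indicator right_diff_distrib)
  qed
  then show ?thesis by simp
qed

section \<open>Functions that are constant almost everywhere on a finite measure space\<close>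

definition centered_indicator :: "'a measure \<Rightarrow> 'a set \<Rightarrow> 'a \<Rightarrow> complex" where
  "centered_indicator N A x = of_real (measure N (space N)) * indicator A x - of_real (measure N A)"

lemma centered_indicator_measurable [measurable]:
  assumes [measurable]: "A \<in> sets N"
  shows "centered_indicator N A \<in> borel_measurable N"
  unfolding centered_indicator_def[abs_def] by measurable

lemma (in finite_measure) integrable_bounded:
  fixes X :: "'a \<Rightarrow> 'b::{banach, second_countable_topology}"
  assumes "X \<in> borel_measurable M" "\<And>x. norm (X x) \<le> B"
  shows "integrable M X"
  by (rule integrable_const_bound[where B = B]) (use assms in auto)

lemma (in finite_measure) complex_indicator_integral:
  assumes A: "A \<in> sets M"
  shows "integrable M (indicator A :: 'a \<Rightarrow> complex)"
    and "(\<integral>x. indicator A x \<partial>M) = complex_of_real (measure M A)"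
proof -
  have eq: "(indicator A :: 'a \<Rightarrow> complex) = (\<lambda>x. of_real (indicat_real A x))"
    by (simp add: of_real_indicator)
  have "integrable M (indicat_real A)"
    using A by (simp add: emeasure_eq_measure)
  then show "integrable M (indicator A :: 'a \<Rightarrow> complex)"
    unfolding eq by simp
  show "(\<integral>x. indicator A x \<partial>M) = complex_of_real (measure M A)"
    unfolding eq integral_complex_of_real using A by (simp add: Int_absorb2 sets.sets_into_space)
qed

lemma (in finite_measure) norm_integral_le_bound:
  fixes X :: "'a \<Rightarrow> 'b::{banach, second_countable_topology}"
  assumes "\<And>x. norm (X x) \<le> B"
  shows "norm (\<integral>x. X x \<partial>M) \<le> B * measure M (space M)"
proof (cases "integrable M X")
  case True
  have "norm (\<integral>x. X x \<partial>M) \<le> (\<integral>x. norm (X x) \<partial>M)"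
    by (rule integral_norm_bound)
  also have "\<dots> \<le> (\<integral>x. B \<partial>M)"
    by (rule integral_mono) (use True assms in auto)
  finally show ?thesis by (simp add: mult.commute)
next
  case False
  \<comment> \<open>A non-integrable function has integral \<open>0\<close> by default, so the bound
    reduces to the nonnegativity of \<open>B\<close>.\<close>
  have "0 \<le> B" using norm_ge_zero assms by (rule order_trans)
  then show ?thesis by (simp add: not_integrable_integral_eq[OF False])
qed

text \<open>Orthogonality to the centered indicator of \<open>A\<close> says that the average of
  \<open>X\<close> over \<open>A\<close> is its average over the whole space. The hypothesis is
  limited to sets of intermediate measure because there the centered indicator has no zeros, and the
  application divides by it.\<close>

lemma (in finite_measure) AE_const_of_centered_integrals:
  fixes X :: "'a \<Rightarrow> complex"
  assumes X: "integrable M X"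
    and cent: "\<And>A. A \<in> sets M \<Longrightarrow> 0 < measure M A \<Longrightarrow> measure M A < measure M (space M) \<Longrightarrow>
      (\<integral>x. centered_indicator M A x * X x \<partial>M) = 0"
  shows "\<exists>c. AE x in M. X x = c"
proof (cases "measure M (space M) = 0")
  case True
  then have "AE x in M. False"
    by (intro AE_I[of _ _ "space M"]) (auto simp: emeasure_eq_measure)
  then show ?thesis by auto
next
  case False
  define m where "m = measure M (space M)"
  have m: "0 < m" using False unfolding m_def by (simp add: less_le)
  \<comment> \<open>The only possible constant is the mean of \<open>X\<close>.\<close>
  define c where "c = (\<integral>x. X x \<partial>M) / of_real m"
  have int: "integrable M (\<lambda>x. indicator A x * X x)" if "A \<in> sets M" for A
    using integrable_mult_indicator[OF that X] by (simp add: scaleR_conv_of_real of_real_indicator)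
  have A_eq: "(\<integral>x. indicator A x * X x \<partial>M) = of_real (measure M A) * c" if A: "A \<in> sets M" for A
  proof -
    \<comment> \<open>Sets of measure \<open>0\<close> or \<open>m\<close> lie outside the
      hypothesis and are treated directly.\<close>
    consider "measure M A = 0" | "measure M A = m" | "0 < measure M A" "measure M A < m"
      using bounded_measure[of A] measure_nonneg[of M A] unfolding m_def by linarith
    then show ?thesis
    proof cases
      case 1
      then have "A \<in> null_sets M" using A by (auto simp: emeasure_eq_measure)
      then have "AE x in M. indicator A x * X x = 0"
        by (rule AE_I') (auto simp: indicator_def)
      from integral_eq_zero_AE[OF this] show ?thesis using 1 by simp
    next
      case 2
      have "measure M (space M - A) = 0"
        using finite_measure_compl[OF A] 2 by (simp add: m_def)
      then have "space M - A \<in> null_sets M" using A by (auto simp: emeasure_eq_measure)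
      then have "AE x in M. indicator A x * X x = X x"
        by (rule AE_I') (auto simp: indicator_def)
      then have "(\<integral>x. indicator A x * X x \<partial>M) = (\<integral>x. X x \<partial>M)"
        using int[OF A] X by (intro integral_cong_AE) auto
      then show ?thesis using 2 m by (simp add: c_def)
    next
      case 3
      have "0 = (\<integral>x. of_real m * (indicator A x * X x) - of_real (measure M A) * X x \<partial>M)"
        using cent[OF A] 3 by (simp add: m_def centered_indicator_def algebra_simps)
      also have "\<dots> = of_real m * (\<integral>x. indicator A x * X x \<partial>M) - of_real (measure M A) * (\<integral>x. X x \<partial>M)"
        using int[OF A] X by simp
      finally show ?thesis using m by (simp add: c_def field_simps)
    qed
  qed
  have "AE x in M. X x - c = 0"
  proof (rule density_zero)
    fix A assume A: "A \<in> sets M"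
    have "(\<integral>x. indicator A x * X x - c * indicator A x \<partial>M) = (\<integral>x. indicator A x * X x \<partial>M) - c * of_real (measure M A)"
      using int[OF A] complex_indicator_integral[OF A] by simp
    then show "set_lebesgue_integral M A (\<lambda>x. X x - c) = 0"
      using A_eq[OF A]
      by (simp add: set_lebesgue_integral_def scaleR_conv_of_real of_real_indicator algebra_simps)
  qed (use X in auto)
  then show ?thesis by auto
qed

lemma complex_const_modulus:
  fixes z :: complex
  assumes "z * cnj z = c"
  shows "cmod z = sqrt (cmod c)"
proof -
  have "cmod c = (cmod z)\<^sup>2"
    unfolding assms[symmetric] by (simp add: norm_mult power2_eq_square)
  then show ?thesis by simp
qed

section \<open>Slice integrals and the factorization of a kernel\<close>

definition slice_integral :: "'a measure \<Rightarrow> ('a \<times> 'a \<Rightarrow> complex) \<Rightarrow> 'a set \<Rightarrow> 'a \<Rightarrow> complex" where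
  "slice_integral N \<phi> C s = (\<integral>t. indicator C t * \<phi> (s, t) \<partial>N)"

text \<open>The kernel of the adjoint operator. Its slice integrals are the conjugates of the
  integrals of \<phi> over the first variable.\<close>

definition adj_kernel :: "('a \<times> 'a \<Rightarrow> complex) \<Rightarrow> 'a \<times> 'a \<Rightarrow> complex" where
  "adj_kernel \<phi> z = cnj (\<phi> (snd z, fst z))"

lemma adj_kernel_measurable [measurable (raw)]:
  assumes [measurable]: "\<phi> \<in> borel_measurable (N \<Otimes>\<^sub>M N)"
  shows "adj_kernel \<phi> \<in> borel_measurable (N \<Otimes>\<^sub>M N)"
  unfolding adj_kernel_def[abs_def] by measurable

lemma unitary_fn_one: "unitary_fn N (\<lambda>x. 1)"
  by (simp add: unitary_fn_def)

context finite_measure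
begin

lemma slice_integral_measurable:
  assumes [measurable]: "\<phi> \<in> borel_measurable (M \<Otimes>\<^sub>M M)" "C \<in> sets M"
  shows "slice_integral M \<phi> C \<in> borel_measurable M"
  unfolding slice_integral_def[abs_def] by measurable

lemma slice_integral_bound:
  assumes "\<And>z. cmod (\<phi> z) \<le> K"
  shows "cmod (slice_integral M \<phi> C s) \<le> K * measure M (space M)"
  unfolding slice_integral_def
proof (rule norm_integral_le_bound)
  show "cmod (indicator C t * \<phi> (s, t)) \<le> K" for t
    using assms[of "(s, t)"] order_trans[OF norm_ge_zero assms]
    by (auto simp: indicator_def norm_mult)
qed

text \<open>In \<open>const\<close> the sets \<open>C\<close> and \<open>D\<close> vary
  independently, which ties the phases of different slices to each other. In
  \<open>const_adj\<close> they coincide, because only a modulus is read off from it.\<close>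

lemma kernel_factorization:
  assumes \<phi>[measurable]: "\<phi> \<in> borel_measurable (M \<Otimes>\<^sub>M M)"
    and bound: "\<And>z. cmod (\<phi> z) \<le> K"
    and const: "\<And>C D. C \<in> sets M \<Longrightarrow> D \<in> sets M \<Longrightarrow>
      \<exists>c. AE s in M. slice_integral M \<phi> C s * cnj (slice_integral M \<phi> D s) = c"
    and const_adj: "\<And>C. C \<in> sets M \<Longrightarrow>
      \<exists>c. AE s in M. slice_integral M (adj_kernel \<phi>) C s * cnj (slice_integral M (adj_kernel \<phi>) C s) = c"
  shows "\<exists>c \<alpha> \<beta>. unitary_fn M \<alpha> \<and> unitary_fn M \<beta> \<and>
      (AE z in M \<Otimes>\<^sub>M M. \<phi> z = c * \<alpha> (fst z) * \<beta> (snd z))"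
proof -
  have sf: "sigma_finite_measure M" by unfold_locales
  have K: "0 \<le> K" using norm_ge_zero bound by (rule order_trans)
  interpret P: pair_sigma_finite M M by unfold_locales
  interpret PF: finite_measure "M \<Otimes>\<^sub>M M"
    by (intro finite_measure_pair_measure) unfold_locales
  let ?P = "slice_integral M \<phi>"
  note [measurable] = slice_integral_measurable[OF \<phi>]
  have int\<phi>: "integrable (M \<Otimes>\<^sub>M M) \<phi>"
    by (rule PF.integrable_bounded[OF \<phi> bound])
  define m where "m = measure M (space M)"
  \<comment> \<open>A kernel vanishing a.e. is covered by \<open>c = 0\<close> with constant
    unitaries.\<close>
  have zero_case: ?thesis if "AE z in M \<Otimes>\<^sub>M M. \<phi> z = 0"
  proof (intro exI conjI)
    show "AE z in M \<Otimes>\<^sub>M M. \<phi> z = 0 * (\<lambda>x. 1) (fst z) * (\<lambda>x. 1) (snd z)" using that by simp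
  qed (rule unitary_fn_one)+
  show ?thesis
  proof (cases "\<forall>C\<in>sets M. AE s in M. ?P C s = 0")
    case True
    have "AE z in M \<Otimes>\<^sub>M M. \<phi> z = 0"
      by (rule AE_eq_of_slice_integrals[OF sf sf int\<phi>])
        (use True in \<open>auto simp: slice_integral_def\<close>)
    then show ?thesis by (rule zero_case)
  next
    case False
    then obtain C0 where C0[measurable]: "C0 \<in> sets M" and ne: "\<not> (AE s in M. ?P C0 s = 0)" by blast
    \<comment> \<open>In a space of measure \<open>0\<close> every function vanishes a.e., contrary
      to \<open>ne\<close>; the division by \<open>m\<close> below relies on this.\<close>
    have m: "m \<noteq> 0"
    proof
      assume "m = 0"
      then have "AE s in M. ?P C0 s = 0"
        by (intro AE_I[of _ _ "space M"]) (auto simp: emeasure_eq_measure m_def)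
      with ne show False by simp
    qed
    obtain c0 where c0: "AE s in M. ?P C0 s * cnj (?P C0 s) = c0"
      using const[OF C0 C0] by blast
    have c0_ne: "c0 \<noteq> 0"
    proof
      assume "c0 = 0"
      with c0 have "AE s in M. ?P C0 s = 0" by simp
      with ne show False by simp
    qed
    define r where "r = sqrt (cmod c0)"
    have r: "0 < r" using c0_ne by (simp add: r_def)
    \<comment> \<open>\<open>sgn\<close> extracts the phase and has modulus at most \<open>1\<close>
      at every point, which the integrability bounds below use.\<close>
    define \<alpha> where "\<alpha> s = sgn (?P C0 s)" for s
    have \<alpha>_eq: "\<alpha> s = ?P C0 s / of_real (cmod (?P C0 s))" for s
      by (simp add: \<alpha>_def complex_sgn_def scaleR_conv_of_real divide_inverse mult.commute)
    have [measurable]: "\<alpha> \<in> borel_measurable M"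
      unfolding \<alpha>_eq[abs_def] by measurable
    have \<alpha>_le: "cmod (\<alpha> s) \<le> 1" for s
      by (simp add: \<alpha>_def norm_sgn)
    have P0: "AE s in M. ?P C0 s = of_real r * \<alpha> s \<and> cmod (\<alpha> s) = 1"
      using c0
    proof eventually_elim
      case (elim s)
      have "cmod (?P C0 s) = r"
        using complex_const_modulus[OF elim] by (simp add: r_def)
      then show ?case using r by (auto simp: \<alpha>_eq norm_divide)
    qed
    have unit\<alpha>: "unitary_fn M \<alpha>"
      using P0 by (auto simp: unitary_fn_def)
    \<comment> \<open>As \<open>?P C0\<close> is \<open>r\<close> times \<alpha> with \<alpha> of
      modulus \<open>1\<close> a.e., multiplying the constancy relation by \<alpha> solves it for
      \<open>?P D\<close>.\<close>
    have slice: "\<exists>b. AE s in M. ?P D s = b * \<alpha> s" if D: "D \<in> sets M" for D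
    proof -
      obtain d where d: "AE s in M. ?P D s * cnj (?P C0 s) = d"
        using const[OF D C0] by blast
      have "AE s in M. ?P D s = d / of_real r * \<alpha> s"
        using d P0
      proof eventually_elim
        case (elim s)
        have "\<alpha> s * cnj (\<alpha> s) = 1"
          using elim by (simp add: complex_norm_square[symmetric])
        then show ?case using elim r by (auto simp: field_simps)
      qed
      then show ?thesis by blast
    qed
    \<comment> \<open>If \<phi>(s,t) = \<alpha>(s) \<beta>(t), then averaging \<phi>(s,t) times the
      conjugate of \<alpha>(s) over \<open>s\<close> returns \<beta>(t).\<close>
    define \<beta>0 where "\<beta>0 t = (\<integral>s. cnj (\<alpha> s) * \<phi> (s, t) \<partial>M) / of_real m" for t
    have int\<alpha>\<phi>: "integrable (M \<Otimes>\<^sub>M M) (\<lambda>z. indicator D (snd z) * (cnj (\<alpha> (fst z)) * \<phi> z))"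
      if [measurable]: "D \<in> sets M" for D
    proof (rule PF.integrable_bounded[where B = K])
      show "cmod (indicator D (snd z) * (cnj (\<alpha> (fst z)) * \<phi> z)) \<le> K" for z
        using mult_mono[OF \<alpha>_le[of "fst z"] bound[of z]] K
        by (auto simp: norm_mult indicator_def)
    qed measurable
    have [measurable]: "\<beta>0 \<in> borel_measurable M"
      unfolding \<beta>0_def[abs_def] by measurable
    have \<beta>0_bound: "cmod (\<beta>0 t) \<le> K * m / \<bar>m\<bar>" for t
    proof -
      have "cmod (cnj (\<alpha> s) * \<phi> (s, t)) \<le> K" for s
        using mult_mono[OF \<alpha>_le[of s] bound[of "(s, t)"]] by (simp add: norm_mult)
      then have "cmod (\<integral>s. cnj (\<alpha> s) * \<phi> (s, t) \<partial>M) \<le> K * m"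
        unfolding m_def by (rule norm_integral_le_bound)
      then show ?thesis
        unfolding \<beta>0_def norm_divide norm_of_real by (rule divide_right_mono) simp
    qed
    \<comment> \<open>Identifies \<open>\<beta>0\<close> as the density of the coefficients:
      exchanging the integrals leaves the mean of the conjugate of \<alpha> times
      \<open>?P D\<close>, which is \<open>b\<close> a.e.\<close>
    have \<beta>0_slice: "(\<integral>t. indicator D t * \<beta>0 t \<partial>M) = b"
      if D: "D \<in> sets M" and b: "AE s in M. ?P D s = b * \<alpha> s" for D b
    proof -
      have [measurable]: "D \<in> sets M" by (rule D)
      have "(\<integral>t. indicator D t * \<beta>0 t \<partial>M)
          = (\<integral>t. (\<integral>s. indicator D t * (cnj (\<alpha> s) * \<phi> (s, t)) \<partial>M) \<partial>M) / of_real m"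
        by (simp add: \<beta>0_def)
      also have "(\<integral>t. (\<integral>s. indicator D t * (cnj (\<alpha> s) * \<phi> (s, t)) \<partial>M) \<partial>M)
          = (\<integral>s. (\<integral>t. indicator D t * (cnj (\<alpha> s) * \<phi> (s, t)) \<partial>M) \<partial>M)"
        by (rule P.Fubini_integral) (use int\<alpha>\<phi>[OF D] in \<open>simp add: case_prod_unfold\<close>)
      also have "\<dots> = (\<integral>s. cnj (\<alpha> s) * ?P D s \<partial>M)"
        unfolding slice_integral_def integral_mult_right_zero[symmetric]
        by (intro Bochner_Integration.integral_cong) (simp_all add: mult_ac)
      also have "\<dots> = (\<integral>s. b \<partial>M)"
      proof (rule integral_cong_AE)
        show "AE s in M. cnj (\<alpha> s) * ?P D s = b"
          using b P0
        proof eventually_elim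
          case (elim s)
          have "\<alpha> s * cnj (\<alpha> s) = 1"
            using elim by (simp add: complex_norm_square[symmetric])
          then show ?case using elim by (simp add: mult_ac)
        qed
      qed measurable
      also have "\<dots> / of_real m = b"
        using m by (simp add: m_def scaleR_conv_of_real)
      finally show ?thesis .
    qed
    have int\<psi>: "integrable (M \<Otimes>\<^sub>M M) (\<lambda>z. \<alpha> (fst z) * \<beta>0 (snd z))"
    proof (rule PF.integrable_bounded)
      show "cmod (\<alpha> (fst z) * \<beta>0 (snd z)) \<le> 1 * (K * m / \<bar>m\<bar>)" for z
        unfolding norm_mult by (intro mult_mono \<alpha>_le \<beta>0_bound) auto
    qed measurable
    have \<phi>_eq: "AE z in M \<Otimes>\<^sub>M M. \<phi> z = \<alpha> (fst z) * \<beta>0 (snd z)"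
    proof (rule AE_eq_of_slice_integrals[OF sf sf int\<phi> int\<psi>])
      fix D assume D: "D \<in> sets M"
      obtain b where b: "AE s in M. ?P D s = b * \<alpha> s" using slice[OF D] by blast
      have "(\<integral>t. indicator D t * (\<alpha> s * \<beta>0 t) \<partial>M) = b * \<alpha> s" for s
      proof -
        have "(\<integral>t. indicator D t * (\<alpha> s * \<beta>0 t) \<partial>M) = (\<integral>t. (indicator D t * \<beta>0 t) * \<alpha> s \<partial>M)"
          by (intro Bochner_Integration.integral_cong) simp_all
        then show ?thesis using \<beta>0_slice[OF D b] by simp
      qed
      then show "AE s in M. (\<integral>t. indicator D t * \<phi> (s, t) \<partial>M)
          = (\<integral>t. indicator D t * (\<alpha> (fst (s, t)) * \<beta>0 (snd (s, t))) \<partial>M)"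
        using b by (simp add: slice_integral_def)
    qed
    \<comment> \<open>Some set must detect \<alpha>, for otherwise \<alpha> would vanish a.e.; the
      nonzero integral becomes the divisor \<open>a\<close> in the computation of the modulus of
      \<open>\<beta>0\<close>.\<close>
    have "\<exists>A\<in>sets M. (\<integral>s. indicator A s * cnj (\<alpha> s) \<partial>M) \<noteq> 0"
    proof (rule ccontr)
      assume "\<not> ?thesis"
      then have "set_lebesgue_integral M A (\<lambda>s. cnj (\<alpha> s)) = 0" if "A \<in> sets M" for A
        using that by (simp add: set_lebesgue_integral_def scaleR_conv_of_real of_real_indicator)
      then have "AE s in M. cnj (\<alpha> s) = 0"
        by (intro density_zero integrable_bounded[where B = 1]) (use \<alpha>_le in auto)
      with P0 have "AE s in M. ?P C0 s = 0" by eventually_elim simp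
      with ne show False by simp
    qed
    then obtain A where A[measurable]: "A \<in> sets M" and a_ne: "(\<integral>s. indicator A s * cnj (\<alpha> s) \<partial>M) \<noteq> 0"
      by blast
    define a where "a = (\<integral>s. indicator A s * cnj (\<alpha> s) \<partial>M)"
    have a: "a \<noteq> 0" using a_ne by (simp add: a_def)
    \<comment> \<open>Slices of \<open>adj_kernel\<close> fix \<open>t\<close>, whereas
      \<open>AE_pair\<close> fixes \<open>s\<close> first, hence the exchange of
      quantifiers.\<close>
    have "AE t in M. AE s in M. \<phi> (s, t) = \<alpha> s * \<beta>0 t"
      using P.AE_pair[OF \<phi>_eq] P.AE_commute[of "\<lambda>s t. \<phi> (s, t) = \<alpha> s * \<beta>0 t"] by simp
    then have R: "AE t in M. slice_integral M (adj_kernel \<phi>) A t = a * cnj (\<beta>0 t)"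
      using AE_space
    proof eventually_elim
      case (elim t)
      have [measurable]: "t \<in> space M" using elim by simp
      have "slice_integral M (adj_kernel \<phi>) A t = (\<integral>s. (indicator A s * cnj (\<alpha> s)) * cnj (\<beta>0 t) \<partial>M)"
        unfolding slice_integral_def adj_kernel_def
        by (rule integral_cong_AE) (use elim in \<open>auto elim!: eventually_mono\<close>)
      then show ?case by (simp add: a_def)
    qed
    obtain c1 where c1: "AE t in M. slice_integral M (adj_kernel \<phi>) A t * cnj (slice_integral M (adj_kernel \<phi>) A t) = c1"
      using const_adj[OF A] by blast
    \<comment> \<open>The adjoint slice has modulus \<open>cmod a\<close> times that of
      \<open>\<beta>0\<close>, and this modulus is \<open>sqrt (cmod c1)\<close> a.e.; so
      \<open>q\<close> is the modulus of \<open>\<beta>0\<close>.\<close>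
    define q where "q = sqrt (cmod c1) / cmod a"
    have q: "AE t in M. cmod (\<beta>0 t) = q"
      using c1 R
    proof eventually_elim
      case (elim t)
      have "cmod a * cmod (\<beta>0 t) = sqrt (cmod c1)"
        using complex_const_modulus[OF elim(1)] elim(2) by (simp add: norm_mult)
      then show ?case using a by (simp add: q_def field_simps)
    qed
    \<comment> \<open>Dividing \<open>\<beta>0\<close> by \<open>q\<close> gives the second unitary
      if \<open>q\<close> is nonzero; for \<open>q = 0\<close> the kernel vanishes a.e.\<close>
    show ?thesis
    proof (cases "q = 0")
      case True
      have "AE z in M \<Otimes>\<^sub>M M. \<phi> z = 0"
      proof -
        have "AE s in M. AE t in M. \<phi> (s, t) = 0"
          using P.AE_pair[OF \<phi>_eq]
        proof eventually_elim
          case (elim s)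
          then show ?case using q by eventually_elim (use True in simp)
        qed
        then show ?thesis
          by (intro P.AE_pair_measure) auto
      qed
      then show ?thesis by (rule zero_case)
    next
      case False
      have "q \<ge> 0" by (simp add: q_def)
      then have "unitary_fn M (\<lambda>t. \<beta>0 t / of_real q)"
        using q False by (auto simp: unitary_fn_def norm_divide elim!: eventually_mono)
      moreover have "AE z in M \<Otimes>\<^sub>M M. \<phi> z = of_real q * \<alpha> (fst z) * (\<beta>0 (snd z) / of_real q)"
        using \<phi>_eq False by simp
      ultimately show ?thesis using unit\<alpha> by blast
    qed
  qed
qed

end

section \<open>Multiplier operators and kernel operators\<close>

text \<open>In each of the two products the adjacent multipliers are conjugate to each other and
  cancel, since their modulus is \<open>1\<close> a.e. What remains is a scalar multiple of the
  original product between outer multipliers.\<close>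

lemma op_disjoint_mult_conj:
  assumes u: "unitary_fn M \<alpha>" "unitary_fn M \<beta>"
    and ab: "bounded_op M a" "bounded_op M b" and disj: "op_disjoint M a b"
  shows "op_disjoint M (mult_conj c \<alpha> \<beta> a) (mult_conj c \<alpha> \<beta> b)"
proof -
  obtain a' b' where adj: "op_adjoint M a a'" "op_adjoint M b b'"
    and zero: "op_eq M (\<lambda>h. a' (b h)) (\<lambda>h s. 0)" "op_eq M (\<lambda>h. a (b' h)) (\<lambda>h s. 0)"
    using disj by (auto simp: op_disjoint_def)
  have bdd': "bounded_op M a'" "bounded_op M b'"
    using adj by (auto simp: op_adjoint_def)
  let ?\<alpha>' = "\<lambda>s. cnj (\<alpha> s)" and ?\<beta>' = "\<lambda>s. cnj (\<beta> s)"
  note u' = unitary_fn_cnj[OF u(1)] unitary_fn_cnj[OF u(2)]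
  have adjoint: "op_adjoint M (mult_conj c \<alpha> \<beta> x) (mult_conj (cnj c) ?\<beta>' ?\<alpha>' x')"
    if "op_adjoint M x x'" for x x'
    using that op_adjoint_mult_conj[OF u that] bounded_op_mult_conj[OF u'(2,1)]
    by (simp add: op_adjoint_def)
  \<comment> \<open>Stated for general multipliers to serve both products: the cancelling function
    \<delta> is \<alpha> in the first and the conjugate of \<beta> in the second.\<close>
  have cancel: "op_eq M (\<lambda>h. mult_conj d \<gamma> (\<lambda>s. cnj (\<delta> s)) x (mult_conj e \<delta> \<epsilon> y h)) (\<lambda>h s. 0)"
    if x: "bounded_op M x" and y: "bounded_op M y" and \<delta>: "unitary_fn M \<delta>" and \<epsilon>: "unitary_fn M \<epsilon>"
      and z: "op_eq M (\<lambda>h. x (y h)) (\<lambda>h s. 0)"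
    for d e \<gamma> \<delta> \<epsilon> and x y :: "'a op"
    unfolding op_eq_def
  proof
    fix h assume h: "h \<in> L2 M"
    let ?g = "y (\<lambda>t. \<epsilon> t * h t)"
    have h': "(\<lambda>t. \<epsilon> t * h t) \<in> L2 M" by (rule L2_unitary_mult[OF \<epsilon> h])
    have g: "?g \<in> L2 M" by (rule bounded_op_L2[OF y h'])
    have "AE s in M. x (\<lambda>t. cnj (\<delta> t) * mult_conj e \<delta> \<epsilon> y h t) s = x (\<lambda>t. e * ?g t) s"
    proof (rule bounded_op_cong[OF x])
      show "(\<lambda>t. cnj (\<delta> t) * mult_conj e \<delta> \<epsilon> y h t) \<in> L2 M"
        by (intro L2_unitary_mult unitary_fn_cnj \<delta> bounded_op_L2[OF bounded_op_mult_conj[OF \<delta> \<epsilon> y] h])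
      show "(\<lambda>t. e * ?g t) \<in> L2 M" by (rule L2_scale[OF g])
      have "AE t in M. cmod (\<delta> t) = 1" using \<delta> by (simp add: unitary_fn_def)
      then show "AE t in M. cnj (\<delta> t) * mult_conj e \<delta> \<epsilon> y h t = e * ?g t"
      proof eventually_elim
        case (elim t)
        have "\<delta> t * cnj (\<delta> t) = 1" using elim by (simp add: complex_norm_square[symmetric])
        then show ?case by (simp add: mult_conj_def mult_ac)
      qed
    qed
    moreover have "AE s in M. x ?g s = 0" using z h' by (simp add: op_eq_def)
    ultimately show "AE s in M. mult_conj d \<gamma> (\<lambda>s. cnj (\<delta> s)) x (mult_conj e \<delta> \<epsilon> y h) s = 0"
      using bounded_op_scale_arg[OF x g, of e]
      by eventually_elim (simp add: mult_conj_def)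
  qed
  have "op_eq M (\<lambda>h. mult_conj (cnj c) ?\<beta>' ?\<alpha>' a' (mult_conj c \<alpha> \<beta> b h)) (\<lambda>h s. 0)"
    by (rule cancel[OF bdd'(1) ab(2) u zero(1)])
  moreover have "op_eq M (\<lambda>h. mult_conj c \<alpha> \<beta> a (mult_conj (cnj c) ?\<beta>' ?\<alpha>' b' h)) (\<lambda>h s. 0)"
    using cancel[OF ab(1) bdd'(2) u'(2,1) zero(2), of c \<alpha>] by simp
  ultimately show ?thesis
    unfolding op_disjoint_def using adjoint[OF adj(1)] adjoint[OF adj(2)] by blast
qed

section \<open>Operators given by kernels\<close>

context sigma_finite_measure
begin

lemma pair_sf: "pair_sigma_finite M M"
  by (simp add: pair_sigma_finite_def sigma_finite_measure_axioms)

lemma kernel_op_cong_AE: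
  assumes [measurable]: "f \<in> borel_measurable (M \<Otimes>\<^sub>M M)" "f' \<in> borel_measurable (M \<Otimes>\<^sub>M M)"
    and eq: "AE z in M \<Otimes>\<^sub>M M. f z = f' z"
  shows "op_eq M (kernel_op M f) (kernel_op M f')"
  unfolding op_eq_def
proof
  interpret P: pair_sigma_finite M M by (rule pair_sf)
  fix h assume "h \<in> L2 M"
  then have [measurable]: "h \<in> borel_measurable M" by (rule L2_measurable)
  show "AE s in M. kernel_op M f h s = kernel_op M f' h s"
    using P.AE_pair[OF eq] AE_space
  proof eventually_elim
    case (elim s)
    have [measurable]: "s \<in> space M" by fact
    show ?case
      unfolding kernel_op_def
      by (rule integral_cong_AE) (use elim in \<open>auto elim!: eventually_mono\<close>)
  qed
qed

lemma kernel_op_factorized: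
  assumes [measurable]: "\<phi> \<in> borel_measurable (M \<Otimes>\<^sub>M M)" "f \<in> borel_measurable (M \<Otimes>\<^sub>M M)"
    "\<alpha> \<in> borel_measurable M" "\<beta> \<in> borel_measurable M"
    and eq: "AE z in M \<Otimes>\<^sub>M M. \<phi> z = c * \<alpha> (fst z) * \<beta> (snd z)"
  shows "op_eq M (kernel_op M (\<lambda>z. \<phi> z * f z)) (mult_conj c \<alpha> \<beta> (kernel_op M f))"
proof -
  have "op_eq M (kernel_op M (\<lambda>z. \<phi> z * f z)) (kernel_op M (\<lambda>z. c * \<alpha> (fst z) * \<beta> (snd z) * f z))"
    by (rule kernel_op_cong_AE) (use eq in auto)
  moreover have "kernel_op M (\<lambda>z. c * \<alpha> (fst z) * \<beta> (snd z) * f z) = mult_conj c \<alpha> \<beta> (kernel_op M f)"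
    unfolding kernel_op_def mult_conj_def fun_eq_iff integral_mult_right_zero[symmetric]
    by (intro allI Bochner_Integration.integral_cong) simp_all
  ultimately show ?thesis by simp
qed

text \<open>Supplies the operator \<open>E\<close> of (i). Agreement with the Schur multiplier is
  \<open>kernel_op_factorized\<close>, and the Schatten bound has constant
  \<open>cmod c\<close>.\<close>

lemma schur_bounded_ext_mult_conj:
  assumes \<phi>: "\<phi> \<in> borel_measurable (M \<Otimes>\<^sub>M M)" and p: "0 < p"
    and u: "unitary_fn M \<alpha>" "unitary_fn M \<beta>"
    and eq: "AE z in M \<Otimes>\<^sub>M M. \<phi> z = c * \<alpha> (fst z) * \<beta> (snd z)"
  shows "schur_bounded_ext M p \<phi> (mult_conj c \<alpha> \<beta>)"
  unfolding schur_bounded_ext_def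
proof (intro conjI allI impI exI)
  fix x y d
  show "in_schatten M p (mult_conj c \<alpha> \<beta> x)" if "in_schatten M p x"
    by (rule in_schatten_mult_conj(1)[OF u that p])
  show "schatten_norm M p (mult_conj c \<alpha> \<beta> x) \<le> cmod c * schatten_norm M p x" if "in_schatten M p x"
    by (rule in_schatten_mult_conj(2)[OF u that p])
  show "op_eq M (mult_conj c \<alpha> \<beta> x) (mult_conj c \<alpha> \<beta> y)"
    if "in_schatten M p x \<and> in_schatten M p y \<and> op_eq M x y"
    unfolding op_eq_def
  proof
    fix h assume "h \<in> L2 M"
    then have "AE s in M. x (\<lambda>t. \<beta> t * h t) s = y (\<lambda>t. \<beta> t * h t) s"
      using that L2_unitary_mult[OF u(2)] by (simp add: op_eq_def)
    then show "AE s in M. mult_conj c \<alpha> \<beta> x h s = mult_conj c \<alpha> \<beta> y h s"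
      by eventually_elim (simp add: mult_conj_def)
  qed
  show "op_eq M (mult_conj c \<alpha> \<beta> (\<lambda>h s. x h s + d * y h s))
      (\<lambda>h s. mult_conj c \<alpha> \<beta> x h s + d * mult_conj c \<alpha> \<beta> y h s)"
    by (simp add: op_eq_def mult_conj_def algebra_simps)
next
  fix f assume "f \<in> L2 (M \<Otimes>\<^sub>M M) \<and> in_schatten M p (kernel_op M f)"
  then have "f \<in> borel_measurable (M \<Otimes>\<^sub>M M)" by (auto simp: L2_def)
  from kernel_op_factorized[OF \<phi> this _ _ eq] u
  have "op_eq M (kernel_op M (\<lambda>z. \<phi> z * f z)) (mult_conj c \<alpha> \<beta> (kernel_op M f))"
    by (simp add: unitary_fn_def)
  then show "op_eq M (mult_conj c \<alpha> \<beta> (kernel_op M f)) (kernel_op M (\<lambda>z. \<phi> z * f z))"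
    by (simp add: op_eq_def eq_commute)
qed

lemma L2_tensor:
  assumes "u \<in> L2 M" "v \<in> L2 M"
  shows "(\<lambda>z. u (fst z) * v (snd z)) \<in> L2 (M \<Otimes>\<^sub>M M)"
proof -
  interpret P: pair_sigma_finite M M by (rule pair_sf)
  have [measurable]: "u \<in> borel_measurable M" "v \<in> borel_measurable M"
    using assms by (auto simp: L2_def)
  have "integrable (M \<Otimes>\<^sub>M M) (\<lambda>z. (cmod (u (fst z) * v (snd z)))\<^sup>2)"
    by (rule P.Fubini_integrable)
      (use assms in \<open>auto simp: L2_def norm_mult power_mult_distrib\<close>)
  then show ?thesis by (auto simp: L2_def)
qed

lemma kernel_op_adjoint:
  assumes f: "f \<in> L2 (M \<Otimes>\<^sub>M M)" and x: "x \<in> L2 M" and y: "y \<in> L2 M"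
  shows "l2_inner M (kernel_op M f x) y = l2_inner M x (kernel_op M (adj_kernel f) y)"
proof -
  interpret P: pair_sigma_finite M M by (rule pair_sf)
  \<comment> \<open>Integrability for Fubini: \<open>f\<close> and the tensor of the conjugate of
    \<open>y\<close> with \<open>x\<close> are both square-integrable on the product.\<close>
  have int: "integrable (M \<Otimes>\<^sub>M M) (\<lambda>z. f z * (cnj (y (fst z)) * x (snd z)))"
    by (rule L2_integrable_mult[OF f L2_tensor[OF L2_cnj[OF y] x]])
  have "l2_inner M (kernel_op M f x) y = (\<integral>s. (\<integral>t. f (s, t) * (cnj (y s) * x t) \<partial>M) \<partial>M)"
    unfolding l2_inner_def kernel_op_def integral_mult_left_zero[symmetric]
    by (intro Bochner_Integration.integral_cong) simp_all
  also have "\<dots> = (\<integral>t. (\<integral>s. f (s, t) * (cnj (y s) * x t) \<partial>M) \<partial>M)"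
    by (rule P.Fubini_integral[symmetric]) (use int in \<open>simp add: case_prod_unfold\<close>)
  also have "\<dots> = l2_inner M x (kernel_op M (adj_kernel f) y)"
    unfolding l2_inner_def kernel_op_def adj_kernel_def
      Bochner_Integration.integral_cnj[symmetric] integral_mult_right_zero[symmetric]
    by (intro Bochner_Integration.integral_cong) simp_all
  finally show ?thesis .
qed

end

section \<open>Weighted rank-one kernels\<close>

text \<open>Trades the sigma-finite measure for a finite measure \<open>N\<close> with the same null
  sets. Multiplication by the square root \<open>g\<close> of the density turns integrals over
  \<open>N\<close> into inner products in L2 of \<open>M\<close>.\<close>

locale positive_weight = sigma_finite_measure M for M :: "'a measure" +
  fixes w :: "'a \<Rightarrow> real"
  assumes w_measurable [measurable]: "w \<in> borel_measurable M"
    and w_pos: "\<And>x. 0 < w x"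
    and w_integrable: "integrable M w"
begin

definition N :: "'a measure" where "N = density M (\<lambda>x. ennreal (w x))"

definition g :: "'a \<Rightarrow> complex" where "g x = complex_of_real (sqrt (w x))"

text \<open>The second factor carries no conjugate: the functions inserted later are the constant
  \<open>1\<close> and a centered indicator, both real-valued.\<close>

definition tensor_kernel :: "('a \<Rightarrow> complex) \<Rightarrow> 'a \<times> 'a \<Rightarrow> complex" where
  "tensor_kernel x z = (g (fst z) * x (fst z)) * (g (snd z) * x (snd z))"

lemma sets_N [simp, measurable_cong]: "sets N = sets M"
  by (simp add: N_def)

lemma space_N [simp]: "space N = space M"
  by (simp add: N_def)

lemma borel_measurable_N [simp]: "borel_measurable N = borel_measurable M"
  by (rule measurable_cong_sets) auto

lemma sets_NN: "sets (N \<Otimes>\<^sub>M N) = sets (M \<Otimes>\<^sub>M M)"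
  by (rule sets_pair_measure_cong) simp_all

lemma borel_measurable_NN [simp]: "borel_measurable (N \<Otimes>\<^sub>M N) = borel_measurable (M \<Otimes>\<^sub>M M)"
  by (rule measurable_cong_sets) (auto simp: sets_NN)

lemma g_measurable [measurable]: "g \<in> borel_measurable M"
  unfolding g_def[abs_def] by measurable

lemma cnj_g [simp]: "cnj (g x) = g x"
  by (simp add: g_def)

lemma g_mult_g: "g x * g x = of_real (w x)"
  using w_pos[of x] by (simp add: g_def flip: of_real_mult)

lemma g_nonzero: "g x \<noteq> 0"
  using w_pos[of x] by (simp add: g_def)

lemma finite_measure_N: "finite_measure N"
proof
  have "emeasure N (space N) = (\<integral>\<^sup>+x. ennreal (w x) \<partial>M)"
    by (simp add: N_def emeasure_density cong: nn_integral_cong)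
  also have "\<dots> = ennreal (\<integral>x. w x \<partial>M)"
    using w_pos by (intro nn_integral_eq_integral w_integrable) (auto intro: less_imp_le)
  finally show "emeasure N (space N) \<noteq> \<infinity>" by simp
qed

lemma AE_N: "(AE x in N. P x) \<longleftrightarrow> (AE x in M. P x)"
  unfolding N_def using w_pos by (subst AE_density) auto

text \<open>For measurable \<open>Q\<close> both sides are iterated a.e. statements, and
  \<open>AE_N\<close> transfers each of the two quantifiers.\<close>

lemma AE_NN:
  assumes Q: "{z \<in> space (M \<Otimes>\<^sub>M M). Q z} \<in> sets (M \<Otimes>\<^sub>M M)"
  shows "(AE z in N \<Otimes>\<^sub>M N. Q z) \<longleftrightarrow> (AE z in M \<Otimes>\<^sub>M M. Q z)"
proof -
  interpret N: finite_measure N by (rule finite_measure_N)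
  interpret PM: pair_sigma_finite M M by (rule pair_sf)
  interpret PN: pair_sigma_finite N N by (rule N.pair_sf)
  have "(AE z in N \<Otimes>\<^sub>M N. Q z) \<longleftrightarrow> (AE s in N. AE t in N. Q (s, t))"
    using PN.AE_pair[of Q] PN.AE_pair_measure[of Q] Q by (auto simp: sets_NN space_pair_measure)
  also have "\<dots> \<longleftrightarrow> (AE s in M. AE t in M. Q (s, t))"
    by (simp add: AE_N)
  also have "\<dots> \<longleftrightarrow> (AE z in M \<Otimes>\<^sub>M M. Q z)"
    using PM.AE_pair[of Q] PM.AE_pair_measure[of Q] Q by blast
  finally show ?thesis .
qed

lemma unitary_fn_N: "unitary_fn N \<alpha> \<longleftrightarrow> unitary_fn M \<alpha>"
  by (simp add: unitary_fn_def AE_N)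

lemma integral_N:
  fixes X :: "'a \<Rightarrow> complex"
  assumes "X \<in> borel_measurable M"
  shows "(\<integral>x. X x \<partial>N) = (\<integral>x. g x * g x * X x \<partial>M)"
  unfolding N_def g_mult_g
  by (subst integral_density) (use assms w_pos in \<open>auto simp: scaleR_conv_of_real intro: less_imp_le\<close>)

lemma L2_g:
  assumes "q \<in> borel_measurable M" "AE x in M. cmod (q x) \<le> B"
  shows "(\<lambda>x. g x * q x) \<in> L2 M"
proof -
  have "(cmod (g x))\<^sup>2 = w x" for x
    using w_pos[of x] by (simp add: g_def)
  then have "g \<in> L2 M"
    using w_integrable by (simp add: L2_def)
  from L2_mult_bounded[OF this assms] show ?thesis by (simp add: mult.commute)
qed

lemma l2_inner_g:
  assumes [measurable]: "X \<in> borel_measurable M" "Y \<in> borel_measurable M"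
  shows "l2_inner M (\<lambda>s. g s * X s) (\<lambda>s. g s * Y s) = (\<integral>s. X s * cnj (Y s) \<partial>N)"
proof -
  have "(\<integral>s. X s * cnj (Y s) \<partial>N) = (\<integral>s. g s * g s * (X s * cnj (Y s)) \<partial>M)"
    by (intro integral_N) measurable
  also have "\<dots> = l2_inner M (\<lambda>s. g s * X s) (\<lambda>s. g s * Y s)"
    unfolding l2_inner_def by (intro Bochner_Integration.integral_cong) simp_all
  finally show ?thesis by simp
qed

text \<open>One factor \<open>g\<close> from the kernel and one from the argument combine to the
  density of \<open>N\<close>. Choosing \<open>q\<close> as an indicator divided by \<open>x\<close>
  then produces a slice integral of \<phi>.\<close>

lemma kernel_op_tensor_kernel:
  assumes [measurable]: "\<phi> \<in> borel_measurable (M \<Otimes>\<^sub>M M)" "x \<in> borel_measurable M"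
    "q \<in> borel_measurable M" and s: "s \<in> space M"
  shows "kernel_op M (\<lambda>z. \<phi> z * tensor_kernel x z) (\<lambda>t. g t * q t) s
    = g s * (x s * (\<integral>t. x t * q t * \<phi> (s, t) \<partial>N))"
proof -
  have [measurable]: "s \<in> space M" by (rule s)
  have "(\<integral>t. x t * q t * \<phi> (s, t) \<partial>N) = (\<integral>t. g t * g t * (x t * q t * \<phi> (s, t)) \<partial>M)"
    by (rule integral_N) measurable
  then show ?thesis
    unfolding kernel_op_def tensor_kernel_def
    by (simp only: integral_mult_right_zero[symmetric])
      (intro Bochner_Integration.integral_cong, simp_all)
qed

lemma L2_tensor_kernel:
  assumes "x \<in> borel_measurable M" "\<And>s. cmod (x s) \<le> B"
  shows "tensor_kernel x \<in> L2 (M \<Otimes>\<^sub>M M)"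
  unfolding tensor_kernel_def[abs_def]
  by (rule L2_tensor; rule L2_g[where B = B]; use assms in simp)

lemma in_schatten_tensor_kernel:
  assumes "x \<in> borel_measurable M" "\<And>s. cmod (x s) \<le> B"
  shows "in_schatten M p (kernel_op M (tensor_kernel x))"
  unfolding tensor_kernel_def[abs_def]
  by (rule in_schatten_rank_one; rule L2_g[where B = B]; use assms in simp)

text \<open>Real symmetric kernels give self-adjoint operators, so the two products in the
  definition of disjointness coincide. The product vanishes because \<open>g x\<close> and
  \<open>g y\<close> are orthogonal.\<close>

lemma op_disjoint_tensor_kernel:
  assumes x: "x \<in> borel_measurable M" "\<And>s. cmod (x s) \<le> B" "\<And>s. cnj (x s) = x s"
    and y: "y \<in> borel_measurable M" "\<And>s. cmod (y s) \<le> C" "\<And>s. cnj (y s) = y s"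
    and orth: "(\<integral>s. y s * x s \<partial>N) = 0"
  shows "op_disjoint M (kernel_op M (tensor_kernel x)) (kernel_op M (tensor_kernel y))"
proof -
  have self_adj: "op_adjoint M (kernel_op M (tensor_kernel x)) (kernel_op M (tensor_kernel x))"
    if "x \<in> borel_measurable M" "\<And>s. cmod (x s) \<le> B" "\<And>s. cnj (x s) = x s" for x B
  proof -
    have "bounded_op M (kernel_op M (tensor_kernel x))"
      using in_schatten_tensor_kernel[OF that(1,2), where p = 1] by (simp add: in_schatten_def)
    moreover have "adj_kernel (tensor_kernel x) = tensor_kernel x"
      by (simp add: adj_kernel_def tensor_kernel_def fun_eq_iff that(3) mult_ac)
    ultimately show ?thesis
      using kernel_op_adjoint[OF L2_tensor_kernel[OF that(1,2)]] by (simp add: op_adjoint_def)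
  qed
  have rank_one: "kernel_op M (tensor_kernel x) h s = (g s * x s) * l2_inner M h (\<lambda>t. g t * x t)"
    if "\<And>s. cnj (x s) = x s" for x h s
    unfolding kernel_op_def tensor_kernel_def l2_inner_def integral_mult_right_zero[symmetric]
    by (intro Bochner_Integration.integral_cong) (simp_all add: that)
  have "l2_inner M (kernel_op M (tensor_kernel y) h) (\<lambda>t. g t * x t) = 0" for h
  proof -
    let ?d = "l2_inner M h (\<lambda>t. g t * y t)"
    have "l2_inner M (kernel_op M (tensor_kernel y) h) (\<lambda>t. g t * x t)
        = ?d * l2_inner M (\<lambda>t. g t * y t) (\<lambda>t. g t * x t)"
      unfolding rank_one[OF y(3)] l2_inner_def[of M _ "\<lambda>t. g t * x t"] integral_mult_right_zero[symmetric]
      by (intro Bochner_Integration.integral_cong) simp_all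
    then show ?thesis
      using orth by (simp add: l2_inner_g[OF y(1) x(1)] x(3))
  qed
  then have "kernel_op M (tensor_kernel x) (kernel_op M (tensor_kernel y) h) s = 0" for h s
    by (simp add: rank_one[OF x(3)])
  then have "op_eq M (\<lambda>h. kernel_op M (tensor_kernel x) (kernel_op M (tensor_kernel y) h)) (\<lambda>h s. 0)"
    by (simp add: op_eq_def)
  then show ?thesis
    unfolding op_disjoint_def using self_adj[OF x] self_adj[OF y] by blast
qed

text \<open>\<open>a\<close> and \<open>b\<close> stand for the images under a separating map, known
  to be kernel operators only up to \<open>op_eq\<close>. The vanishing of \<open>a' b\<close> gives
  the first relation, that of \<open>a b'\<close> the second.\<close>

lemma disjoint_images_orthogonality:
  assumes \<phi>: "\<phi> \<in> borel_measurable (M \<Otimes>\<^sub>M M)" "\<And>z. cmod (\<phi> z) \<le> K"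
    and k[measurable]: "k \<in> borel_measurable M"
    and k_bound: "\<And>s. cmod (k s) \<le> B" and k_inv: "\<And>s. cmod (inverse (k s)) \<le> B"
    and k_ne: "\<And>s. k s \<noteq> 0" and k_real: "\<And>s. cnj (k s) = k s"
    and bdd: "bounded_op M a" "bounded_op M b"
    and a: "op_eq M a (kernel_op M (\<lambda>z. \<phi> z * tensor_kernel (\<lambda>s. 1) z))"
    and b: "op_eq M b (kernel_op M (\<lambda>z. \<phi> z * tensor_kernel k z))"
    and disj: "op_disjoint M a b"
    and C: "C \<in> sets M" and D: "D \<in> sets M"
  shows "(\<integral>s. k s * (slice_integral N \<phi> C s * cnj (slice_integral N \<phi> D s)) \<partial>N) = 0"
    and "(\<integral>s. k s * (slice_integral N (adj_kernel \<phi>) C s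
          * cnj (slice_integral N (adj_kernel \<phi>) D s)) \<partial>N) = 0"
proof -
  interpret N: finite_measure N by (rule finite_measure_N)
  note [measurable] = \<phi>(1) C D
  define u where "u t = g t * indicator C t" for t
  \<comment> \<open>The factor \<open>inverse (k t)\<close> cancels \<open>k t\<close> in the kernel
    of \<open>G\<close>, so that \<open>G\<close> applied to \<open>v\<close> retains
    \<open>k\<close> in the outer variable only.\<close>
  define v where "v t = g t * (inverse (k t) * indicator D t)" for t
  \<comment> \<open>Parametrised by the symbol, so that the same formulas apply to \<phi> and to
    \<open>adj_kernel \<phi>\<close>.\<close>
  define F where "F \<psi> = kernel_op M (\<lambda>z. \<psi> z * tensor_kernel (\<lambda>s. 1) z)" for \<psi>
  define G where "G \<psi> = kernel_op M (\<lambda>z. \<psi> z * tensor_kernel k z)" for \<psi>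
  have B: "0 \<le> B" using norm_ge_zero k_bound by (rule order_trans)
  have u: "u \<in> L2 M"
    unfolding u_def[abs_def] by (rule L2_g[where B = 1]) (auto simp: indicator_def)
  have v: "v \<in> L2 M"
    unfolding v_def[abs_def]
    by (rule L2_g[where B = B]) (use k_inv B in \<open>auto simp: indicator_def norm_mult\<close>)
  have slice: "slice_integral N \<psi> E \<in> borel_measurable M" if "\<psi> \<in> borel_measurable (M \<Otimes>\<^sub>M M)" "E \<in> sets M"
    for \<psi> E
    using N.slice_integral_measurable[of \<psi> E] that by simp
  have Fu: "F \<psi> u s = g s * slice_integral N \<psi> C s"
    if "\<psi> \<in> borel_measurable (M \<Otimes>\<^sub>M M)" "s \<in> space M" for \<psi> s
    unfolding F_def u_def[abs_def] using that
    by (subst kernel_op_tensor_kernel) (auto simp: slice_integral_def)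
  have Gv: "G \<psi> v s = g s * (k s * slice_integral N \<psi> D s)"
    if "\<psi> \<in> borel_measurable (M \<Otimes>\<^sub>M M)" "s \<in> space M" for \<psi> s
    unfolding G_def v_def[abs_def] using that
    by (subst kernel_op_tensor_kernel) (auto simp: slice_integral_def k_ne mult.assoc[symmetric])
  have inner: "l2_inner M (F \<psi> u) (G \<psi> v)
      = (\<integral>s. k s * (slice_integral N \<psi> C s * cnj (slice_integral N \<psi> D s)) \<partial>N)"
    if \<psi>: "\<psi> \<in> borel_measurable (M \<Otimes>\<^sub>M M)" for \<psi>
  proof -
    have "l2_inner M (F \<psi> u) (G \<psi> v)
        = l2_inner M (\<lambda>s. g s * slice_integral N \<psi> C s) (\<lambda>s. g s * (k s * slice_integral N \<psi> D s))"
      unfolding l2_inner_def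
      by (intro Bochner_Integration.integral_cong) (simp_all add: Fu[OF \<psi>] Gv[OF \<psi>])
    also have "\<dots> = (\<integral>s. slice_integral N \<psi> C s * cnj (k s * slice_integral N \<psi> D s) \<partial>N)"
      by (rule l2_inner_g) (use slice[OF \<psi>] C D in auto)
    finally show ?thesis by (simp add: k_real mult_ac)
  qed
  have L2F: "(\<lambda>z. \<phi> z * tensor_kernel (\<lambda>s. 1) z) \<in> L2 (M \<Otimes>\<^sub>M M)"
    by (rule L2_mult_bounded[where C = K], rule L2_tensor_kernel[where B = 1]) (use \<phi> in auto)
  have L2G: "(\<lambda>z. \<phi> z * tensor_kernel k z) \<in> L2 (M \<Otimes>\<^sub>M M)"
    by (rule L2_mult_bounded[where C = K], rule L2_tensor_kernel[where B = B]) (use \<phi> k_bound in auto)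
  have adj_tensor: "adj_kernel (\<lambda>z. \<phi> z * tensor_kernel x z) = (\<lambda>z. adj_kernel \<phi> z * tensor_kernel x z)"
    if "\<And>s. cnj (x s) = x s" for x
    by (simp add: adj_kernel_def tensor_kernel_def fun_eq_iff that)
  have adjF: "l2_inner M (F \<phi> x) y = l2_inner M x (F (adj_kernel \<phi>) y)"
    if "x \<in> L2 M" "y \<in> L2 M" for x y
    using kernel_op_adjoint[OF L2F that] unfolding F_def adj_tensor[OF complex_cnj_one] .
  have adjG: "l2_inner M (G \<phi> x) y = l2_inner M x (G (adj_kernel \<phi>) y)"
    if "x \<in> L2 M" "y \<in> L2 M" for x y
    using kernel_op_adjoint[OF L2G that] unfolding G_def adj_tensor[OF k_real] .
  have measF: "F \<psi> x \<in> borel_measurable M"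
    if [measurable]: "\<psi> \<in> borel_measurable (M \<Otimes>\<^sub>M M)" "x \<in> borel_measurable M" for \<psi> x
    unfolding F_def kernel_op_def tensor_kernel_def by measurable
  have measG: "G \<psi> x \<in> borel_measurable M"
    if [measurable]: "\<psi> \<in> borel_measurable (M \<Otimes>\<^sub>M M)" "x \<in> borel_measurable M" for \<psi> x
    unfolding G_def kernel_op_def tensor_kernel_def by measurable
  have inner_a: "l2_inner M (a x) y = l2_inner M (F \<phi> x) y" if "x \<in> L2 M" "y \<in> borel_measurable M" for x y
  proof (rule l2_inner_cong_AE)
    show "a x \<in> borel_measurable M"
      by (rule L2_measurable[OF bounded_op_L2[OF bdd(1) that(1)]])
    show "F \<phi> x \<in> borel_measurable M"
      by (rule measF[OF \<phi>(1) L2_measurable[OF that(1)]])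
    show "AE s in M. a x s = F \<phi> x s"
      using a that(1) by (simp add: op_eq_def F_def)
  qed (use that in simp_all)
  have inner_b: "l2_inner M (b x) y = l2_inner M (G \<phi> x) y" if "x \<in> L2 M" "y \<in> borel_measurable M" for x y
  proof (rule l2_inner_cong_AE)
    show "b x \<in> borel_measurable M"
      by (rule L2_measurable[OF bounded_op_L2[OF bdd(2) that(1)]])
    show "G \<phi> x \<in> borel_measurable M"
      by (rule measG[OF \<phi>(1) L2_measurable[OF that(1)]])
    show "AE s in M. b x s = G \<phi> x s"
      using b that(1) by (simp add: op_eq_def G_def)
  qed (use that in simp_all)
  obtain a' b' where adj: "op_adjoint M a a'" "op_adjoint M b b'"
    and zero: "op_eq M (\<lambda>h. a' (b h)) (\<lambda>h s. 0)" "op_eq M (\<lambda>h. a (b' h)) (\<lambda>h s. 0)"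
    using disj by (auto simp: op_disjoint_def)
  have bdd': "bounded_op M a'" "bounded_op M b'"
    using adj by (auto simp: op_adjoint_def)

  have bv: "b v \<in> L2 M" by (rule bounded_op_L2[OF bdd(2) v])
  \<comment> \<open>The inner product is that of \<open>a u\<close> with \<open>b v\<close>, hence
    that of \<open>u\<close> with \<open>a' (b v)\<close>, which vanishes a.e.\<close>
  have "l2_inner M (F \<phi> u) (G \<phi> v) = l2_inner M (F \<phi> u) (b v)"
    using inner_b[OF v measF[OF \<phi>(1) L2_measurable[OF u]]]
    by (subst (1 2) cnj_l2_inner[symmetric]) simp
  also have "\<dots> = l2_inner M (a u) (b v)"
    using inner_a[OF u] bv by (simp add: L2_measurable)
  also have "\<dots> = l2_inner M u (a' (b v))"
    using adj(1) u bv by (simp add: op_adjoint_def)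
  also have "\<dots> = l2_inner M u (\<lambda>s. 0)"
    by (rule l2_inner_cong_AE)
      (use zero(1) v L2_measurable[OF u] L2_measurable[OF bounded_op_L2[OF bdd'(1) bv]] in \<open>auto simp: op_eq_def\<close>)
  finally have "l2_inner M (F \<phi> u) (G \<phi> v) = 0"
    by (simp add: l2_inner_def)
  then show "(\<integral>s. k s * (slice_integral N \<phi> C s * cnj (slice_integral N \<phi> D s)) \<partial>N) = 0"
    using inner[OF \<phi>(1)] by simp

  let ?\<psi> = "adj_kernel \<phi>"
  have \<psi>[measurable]: "?\<psi> \<in> borel_measurable (M \<Otimes>\<^sub>M M)"
    by measurable
  \<comment> \<open>\<open>F ?\<psi>\<close> has not been identified with the bounded operator
    \<open>a'\<close>, so square integrability comes from the pointwise bound on slice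
    integrals.\<close>
  have "F ?\<psi> u \<in> L2 M"
  proof -
    have "(\<lambda>s. g s * slice_integral N ?\<psi> C s) \<in> L2 M"
    proof (rule L2_g)
      show "AE s in M. cmod (slice_integral N ?\<psi> C s) \<le> K * measure N (space N)"
        by (intro AE_I2 N.slice_integral_bound) (simp add: adj_kernel_def \<phi>(2))
    qed (rule slice[OF \<psi> C])
    moreover have "F ?\<psi> u \<in> borel_measurable M"
      using measF[OF \<psi>] u by (simp add: L2_measurable)
    ultimately show ?thesis
      by (simp add: L2_def Fu[OF \<psi>] cong: Bochner_Integration.integrable_cong)
  qed
  note Fu' = this
  have b'v: "b' v \<in> L2 M" by (rule bounded_op_L2[OF bdd'(2) v])
  \<comment> \<open>\<open>F ?\<psi>\<close> and \<open>G ?\<psi>\<close> act as adjoints of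
    \<open>a\<close> and \<open>b\<close>; moving both across the inner product leaves
    \<open>a (b' v)\<close>, which vanishes a.e.\<close>
  have "l2_inner M (F ?\<psi> u) (G ?\<psi> v) = l2_inner M (G \<phi> (F ?\<psi> u)) v"
    by (rule adjG[OF Fu' v, symmetric])
  also have "\<dots> = l2_inner M (b (F ?\<psi> u)) v"
    using inner_b[OF Fu'] v by (simp add: L2_measurable)
  also have "\<dots> = l2_inner M (F ?\<psi> u) (b' v)"
    using adj(2) Fu' v by (simp add: op_adjoint_def)
  also have "\<dots> = cnj (l2_inner M (b' v) (F ?\<psi> u))"
    by (rule cnj_l2_inner[symmetric])
  also have "l2_inner M (b' v) (F ?\<psi> u) = l2_inner M (a (b' v)) u"
    using adjF[OF b'v u] inner_a[OF b'v] u by (simp add: L2_measurable)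
  also have "\<dots> = l2_inner M (\<lambda>s. 0) u"
    by (rule l2_inner_cong_AE)
      (use zero(2) v L2_measurable[OF u] L2_measurable[OF bounded_op_L2[OF bdd(1) b'v]] in \<open>auto simp: op_eq_def\<close>)
  finally have "l2_inner M (F ?\<psi> u) (G ?\<psi> v) = 0"
    by (simp add: l2_inner_def)
  then show "(\<integral>s. k s * (slice_integral N ?\<psi> C s * cnj (slice_integral N ?\<psi> D s)) \<partial>N) = 0"
    using inner[OF \<psi>] by simp
qed

section \<open>Factorization of \<phi> from the operator conditions (i) and (iii)\<close>

lemma factorization_of_separating:
  assumes \<phi>[measurable]: "\<phi> \<in> borel_measurable (M \<Otimes>\<^sub>M M)"
    and ess: "\<exists>C. AE z in M \<Otimes>\<^sub>M M. cmod (\<phi> z) \<le> C"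
    and E: "schur_bounded_ext M p \<phi> E" and sep: "separating M p E"
  shows "\<exists>c \<alpha> \<beta>. unitary_fn M \<alpha> \<and> unitary_fn M \<beta> \<and>
    (AE z in M \<Otimes>\<^sub>M M. \<phi> z = c * \<alpha> (fst z) * \<beta> (snd z))"
proof -
  interpret N: finite_measure N by (rule finite_measure_N)
  obtain C where C: "AE z in M \<Otimes>\<^sub>M M. cmod (\<phi> z) \<le> C" using ess by blast
  \<comment> \<open>Cutting off where the essential bound fails gives a symbol bounded at every
    point; it agrees with \<phi> a.e., so kernel operators change only within
    \<open>op_eq\<close>.\<close>
  define \<psi> where "\<psi> z = (if cmod (\<phi> z) \<le> C then \<phi> z else 0)" for z
  have \<psi>[measurable]: "\<psi> \<in> borel_measurable (M \<Otimes>\<^sub>M M)"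
    unfolding \<psi>_def[abs_def] by measurable
  define K where "K = max C 0"
  have \<psi>_bound: "cmod (\<psi> z) \<le> K" for z
    by (auto simp: \<psi>_def K_def)
  have \<phi>\<psi>: "AE z in M \<Otimes>\<^sub>M M. \<phi> z = \<psi> z"
    using C by eventually_elim (simp add: \<psi>_def)
  have image: "bounded_op M (E (kernel_op M (tensor_kernel x)))"
    "op_eq M (E (kernel_op M (tensor_kernel x))) (kernel_op M (\<lambda>z. \<psi> z * tensor_kernel x z))"
    if x[measurable]: "x \<in> borel_measurable M" and x_bound: "\<And>s. cmod (x s) \<le> B" for x B
  proof -
    have S: "in_schatten M p (kernel_op M (tensor_kernel x))"
      by (rule in_schatten_tensor_kernel[OF x x_bound])
    then show "bounded_op M (E (kernel_op M (tensor_kernel x)))"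
      using E by (simp add: schur_bounded_ext_def in_schatten_def)
    have L: "tensor_kernel x \<in> L2 (M \<Otimes>\<^sub>M M)"
      by (rule L2_tensor_kernel[OF x x_bound])
    have [measurable]: "tensor_kernel x \<in> borel_measurable (M \<Otimes>\<^sub>M M)"
      by (rule L2_measurable[OF L])
    have "op_eq M (E (kernel_op M (tensor_kernel x))) (kernel_op M (\<lambda>z. \<phi> z * tensor_kernel x z))"
      using E S L by (simp add: schur_bounded_ext_def)
    moreover have "op_eq M (kernel_op M (\<lambda>z. \<phi> z * tensor_kernel x z)) (kernel_op M (\<lambda>z. \<psi> z * tensor_kernel x z))"
      by (rule kernel_op_cong_AE) (use \<phi>\<psi> in auto)
    ultimately show "op_eq M (E (kernel_op M (tensor_kernel x))) (kernel_op M (\<lambda>z. \<psi> z * tensor_kernel x z))"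
      by (rule op_eq_trans)
  qed
  have orth: "(\<integral>s. centered_indicator N A s * (slice_integral N \<psi> C s * cnj (slice_integral N \<psi> D s)) \<partial>N) = 0"
    "(\<integral>s. centered_indicator N A s * (slice_integral N (adj_kernel \<psi>) C s
          * cnj (slice_integral N (adj_kernel \<psi>) D s)) \<partial>N) = 0"
    if A: "A \<in> sets M" and A_pos: "0 < measure N A" "measure N A < measure N (space N)"
      and CD: "C \<in> sets M" "D \<in> sets M" for A C D
  proof -
    let ?k = "centered_indicator N A"
    let ?p = "measure N A" and ?q = "measure N (space N) - measure N A"
    \<comment> \<open>\<open>?k\<close> takes the value \<open>?q\<close> on \<open>A\<close> and
      \<open>-?p\<close> off \<open>A\<close>, both nonzero; \<open>B\<close> dominates the moduli
      of these values and of their inverses.\<close>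
    define B where "B = ?p + ?q + inverse ?p + inverse ?q"
    have cases: "?k s = of_real ?q \<or> ?k s = - of_real ?p" for s
      by (cases "s \<in> A") (simp_all add: centered_indicator_def)
    have pq: "0 < ?p" "0 < ?q" using A_pos by auto
    have inv_pq: "0 < inverse ?p" "0 < inverse ?q" using pq by (simp_all only: positive_imp_inverse_positive)
    have B: "?p \<le> B" "?q \<le> B" "inverse ?p \<le> B" "inverse ?q \<le> B"
      unfolding B_def using pq inv_pq by linarith+
    have k: "?k \<in> borel_measurable M"
      using centered_indicator_measurable[of A N] A by simp
    have k_bound: "cmod (?k s) \<le> B" for s
    proof -
      have "cmod (?k s) = ?p \<or> cmod (?k s) = ?q"
        using cases[of s] pq by (metis abs_of_pos norm_minus_cancel norm_of_real)
      then show ?thesis using B by auto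
    qed
    have k_inv: "cmod (inverse (?k s)) \<le> B" for s
    proof -
      have "cmod (inverse (?k s)) = inverse ?p \<or> cmod (inverse (?k s)) = inverse ?q"
        using cases[of s] pq by (metis abs_of_pos norm_inverse norm_minus_cancel norm_of_real)
      then show ?thesis using B by auto
    qed
    have k_ne: "?k s \<noteq> 0" for s
      using cases[of s] pq by (metis less_irrefl neg_equal_0_iff_equal of_real_eq_0_iff)
    have k_real: "cnj (?k s) = ?k s" for s
      using cases[of s] by (metis complex_cnj_complex_of_real complex_cnj_minus)
    \<comment> \<open>Mean zero is orthogonality to the constant \<open>1\<close>, which makes the
      two test operators disjoint.\<close>
    have "(\<integral>s. ?k s * 1 \<partial>N) = 0"
      using N.complex_indicator_integral[of A] A
      by (simp add: centered_indicator_def scaleR_conv_of_real)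
    then have "op_disjoint M (kernel_op M (tensor_kernel (\<lambda>s. 1))) (kernel_op M (tensor_kernel ?k))"
      by (intro op_disjoint_tensor_kernel[where B = 1 and C = B] k k_bound k_real) auto
    then have disj: "op_disjoint M (E (kernel_op M (tensor_kernel (\<lambda>s. 1)))) (E (kernel_op M (tensor_kernel ?k)))"
      using sep in_schatten_tensor_kernel[OF k k_bound, of p]
        in_schatten_tensor_kernel[of "\<lambda>s. 1" 1 p]
      by (auto simp: separating_def)
    have one: "(\<lambda>s. 1 :: complex) \<in> borel_measurable M" "cmod (1 :: complex) \<le> 1" by auto
    note * = disjoint_images_orthogonality[OF \<psi> \<psi>_bound k k_bound k_inv k_ne k_real
        image(1)[OF one] image(1)[OF k k_bound] image(2)[OF one] image(2)[OF k k_bound] disj CD]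
    show "(\<integral>s. ?k s * (slice_integral N \<psi> C s * cnj (slice_integral N \<psi> D s)) \<partial>N) = 0"
      "(\<integral>s. ?k s * (slice_integral N (adj_kernel \<psi>) C s * cnj (slice_integral N (adj_kernel \<psi>) D s)) \<partial>N) = 0"
      by (rule *)+
  qed
  have int: "integrable N (\<lambda>s. slice_integral N \<theta> C s * cnj (slice_integral N \<theta> D s))"
    if \<theta>: "\<theta> \<in> borel_measurable (M \<Otimes>\<^sub>M M)" "\<And>z. cmod (\<theta> z) \<le> K" and CD: "C \<in> sets M" "D \<in> sets M"
    for \<theta> C D
  proof (rule N.integrable_bounded)
    let ?b = "K * measure N (space N)"
    have [measurable]: "slice_integral N \<theta> C \<in> borel_measurable N" "slice_integral N \<theta> D \<in> borel_measurable N"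
      by (rule N.slice_integral_measurable; use \<theta> CD in simp)+
    show "(\<lambda>s. slice_integral N \<theta> C s * cnj (slice_integral N \<theta> D s)) \<in> borel_measurable N"
      by measurable
    show "cmod (slice_integral N \<theta> C s * cnj (slice_integral N \<theta> D s)) \<le> ?b * ?b" for s
      unfolding norm_mult complex_mod_cnj
      by (intro mult_mono N.slice_integral_bound \<theta>) (auto simp: K_def)
  qed
  have adj_bound: "cmod (adj_kernel \<psi> z) \<le> K" for z
    using \<psi>_bound by (simp add: adj_kernel_def)
  have "\<exists>c \<alpha> \<beta>. unitary_fn N \<alpha> \<and> unitary_fn N \<beta> \<and>
      (AE z in N \<Otimes>\<^sub>M N. \<psi> z = c * \<alpha> (fst z) * \<beta> (snd z))"
  proof (rule N.kernel_factorization[OF _ \<psi>_bound])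
    show "\<psi> \<in> borel_measurable (N \<Otimes>\<^sub>M N)" by (simp add: \<psi>)
    show "\<exists>c. AE s in N. slice_integral N \<psi> C s * cnj (slice_integral N \<psi> D s) = c"
      if "C \<in> sets N" "D \<in> sets N" for C D
      by (rule N.AE_const_of_centered_integrals)
        (use that orth(1) int[OF \<psi> \<psi>_bound] in simp_all)
    show "\<exists>c. AE s in N. slice_integral N (adj_kernel \<psi>) C s * cnj (slice_integral N (adj_kernel \<psi>) C s) = c"
      if "C \<in> sets N" for C
      by (rule N.AE_const_of_centered_integrals)
        (use that orth(2) int[OF adj_kernel_measurable[OF \<psi>] adj_bound] in simp_all)
  qed
  then obtain c \<alpha> \<beta> where u: "unitary_fn M \<alpha>" "unitary_fn M \<beta>"
    and eqN: "AE z in N \<Otimes>\<^sub>M N. \<psi> z = c * \<alpha> (fst z) * \<beta> (snd z)"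
    unfolding unitary_fn_N by blast
  have [measurable]: "\<alpha> \<in> borel_measurable M" "\<beta> \<in> borel_measurable M"
    using u by (auto simp: unitary_fn_def)
  have "{z \<in> space (M \<Otimes>\<^sub>M M). \<psi> z = c * \<alpha> (fst z) * \<beta> (snd z)} \<in> sets (M \<Otimes>\<^sub>M M)"
    by measurable
  from eqN[unfolded AE_NN[OF this]] \<phi>\<psi>
  have "AE z in M \<Otimes>\<^sub>M M. \<phi> z = c * \<alpha> (fst z) * \<beta> (snd z)"
    by eventually_elim simp
  with u show ?thesis by blast
qed

text \<open>Testing on the kernel \<open>g\<close> tensor \<open>g\<close> and on \<open>g\<close>
  times indicators suffices: both sides become \<open>g s\<close> times a slice integral over
  \<open>N\<close>, and \<open>g s\<close> is nonzero.\<close>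

lemma factorization_of_mult_conj:
  assumes \<phi>[measurable]: "\<phi> \<in> borel_measurable (M \<Otimes>\<^sub>M M)"
    and ess: "\<exists>C. AE z in M \<Otimes>\<^sub>M M. cmod (\<phi> z) \<le> C"
    and u: "unitary_fn M \<alpha>" "unitary_fn M \<beta>"
    and eq: "\<forall>f\<in>L2 (M \<Otimes>\<^sub>M M). op_eq M (kernel_op M (\<lambda>z. \<phi> z * f z)) (mult_conj c \<alpha> \<beta> (kernel_op M f))"
  shows "AE z in M \<Otimes>\<^sub>M M. \<phi> z = c * \<alpha> (fst z) * \<beta> (snd z)"
proof -
  interpret N: finite_measure N by (rule finite_measure_N)
  interpret PF: finite_measure "N \<Otimes>\<^sub>M N"
    by (intro finite_measure_pair_measure finite_measure_N)
  interpret P: pair_sigma_finite M M by (rule pair_sf)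
  have [measurable]: "\<alpha> \<in> borel_measurable M" "\<beta> \<in> borel_measurable M"
    using u by (auto simp: unitary_fn_def)
  obtain C where C: "AE z in M \<Otimes>\<^sub>M M. cmod (\<phi> z) \<le> C" using ess by blast
  have sf: "sigma_finite_measure N" by unfold_locales
  let ?\<psi> = "\<lambda>z. c * \<alpha> (fst z) * \<beta> (snd z)"
  have "AE z in N \<Otimes>\<^sub>M N. \<phi> z = ?\<psi> z"
  proof (rule AE_eq_of_slice_integrals[OF sf sf])
    have "AE z in N \<Otimes>\<^sub>M N. cmod (\<phi> z) \<le> C"
      by (subst AE_NN) (use C in \<open>auto\<close>)
    then show "integrable (N \<Otimes>\<^sub>M N) \<phi>"
      by (rule PF.integrable_const_bound) simp
    have "AE s in M. AE t in M. cmod (?\<psi> (s, t)) \<le> cmod c"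
    proof -
      have ab: "AE s in M. cmod (\<alpha> s) = 1" "AE t in M. cmod (\<beta> t) = 1"
        using u by (auto simp: unitary_fn_def)
      show ?thesis
        using ab(1)
      proof eventually_elim
        case (elim s)
        show ?case using ab(2) by eventually_elim (simp add: norm_mult elim)
      qed
    qed
    then have "AE z in M \<Otimes>\<^sub>M M. cmod (?\<psi> z) \<le> cmod c"
      by (intro P.AE_pair_measure) auto
    then have "AE z in N \<Otimes>\<^sub>M N. cmod (?\<psi> z) \<le> cmod c"
      by (subst AE_NN) auto
    then show "integrable (N \<Otimes>\<^sub>M N) ?\<psi>"
      by (rule PF.integrable_const_bound) simp
    fix D assume "D \<in> sets N"
    then have [measurable]: "D \<in> sets M" by simp
    let ?f = "tensor_kernel (\<lambda>s. 1)" and ?h = "\<lambda>t. g t * indicator D t"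
    have "?f \<in> L2 (M \<Otimes>\<^sub>M M)" by (rule L2_tensor_kernel[where B = 1]) auto
    moreover have "?h \<in> L2 M" by (rule L2_g[where B = 1]) (auto simp: indicator_def)
    ultimately have "AE s in M. kernel_op M (\<lambda>z. \<phi> z * ?f z) ?h s = mult_conj c \<alpha> \<beta> (kernel_op M ?f) ?h s"
      using eq by (simp add: op_eq_def)
    then have "AE s in M. (\<integral>t. indicator D t * \<phi> (s, t) \<partial>N) = (\<integral>t. indicator D t * ?\<psi> (s, t) \<partial>N)"
      using AE_space
    proof eventually_elim
      case (elim s)
      have "g s * (\<integral>t. indicator D t * \<phi> (s, t) \<partial>N) = kernel_op M (\<lambda>z. \<phi> z * ?f z) ?h s"
        using elim by (subst kernel_op_tensor_kernel) auto
      \<comment> \<open>The constant symbol \<open>1\<close> brings the right-hand side into the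
        form treated by \<open>kernel_op_tensor_kernel\<close>.\<close>
      also have "\<dots> = c * \<alpha> s * kernel_op M (\<lambda>z. 1 * ?f z) (\<lambda>t. g t * (\<beta> t * indicator D t)) s"
        using elim(1) by (simp add: mult_conj_def mult_ac)
      also have "\<dots> = c * \<alpha> s * (g s * (1 * (\<integral>t. 1 * (\<beta> t * indicator D t) * 1 \<partial>N)))"
        using elim by (subst kernel_op_tensor_kernel) auto
      also have "\<dots> = g s * (\<integral>t. indicator D t * ?\<psi> (s, t) \<partial>N)"
        unfolding integral_mult_right_zero[symmetric]
        by (intro Bochner_Integration.integral_cong) simp_all
      finally show ?case using g_nonzero by simp
    qed
    then show "AE s in N. (\<integral>t. indicator D t * \<phi> (s, t) \<partial>N) = (\<integral>t. indicator D t * ?\<psi> (s, t) \<partial>N)"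
      by (simp add: AE_N)
  qed
  then show ?thesis
    by (subst (asm) AE_NN) auto
qed

end

section \<open>Equivalence of the three conditions\<close>

theorem theorem5p1:
  fixes M :: "'a measure" and \<phi> :: "'a \<times> 'a \<Rightarrow> complex" and p :: real
  assumes "sigma_finite_measure M"
    and "\<phi> \<in> borel_measurable (M \<Otimes>\<^sub>M M)"
    and "\<exists>C. AE z in M \<Otimes>\<^sub>M M. cmod (\<phi> z) \<le> C"
    and "1 \<le> p"
  shows "((\<exists>E. schur_bounded_ext M p \<phi> E \<and> separating M p E) \<longleftrightarrow>
          (\<exists>c \<alpha> \<beta>. unitary_fn M \<alpha> \<and> unitary_fn M \<beta> \<and>
             (AE z in M \<Otimes>\<^sub>M M. \<phi> z = c * \<alpha> (fst z) * \<beta> (snd z))))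
       \<and> ((\<exists>c \<alpha> \<beta>. unitary_fn M \<alpha> \<and> unitary_fn M \<beta> \<and>
             (AE z in M \<Otimes>\<^sub>M M. \<phi> z = c * \<alpha> (fst z) * \<beta> (snd z))) \<longleftrightarrow>
          (\<exists>c \<alpha> \<beta>. unitary_fn M \<alpha> \<and> unitary_fn M \<beta> \<and>
             (\<forall>f\<in>L2 (M \<Otimes>\<^sub>M M).
                op_eq M (kernel_op M (\<lambda>z. \<phi> z * f z))
                        (\<lambda>h s. c * \<alpha> s * kernel_op M f (\<lambda>t. \<beta> t * h t) s))))"
    (is "(?i \<longleftrightarrow> ?ii) \<and> (?ii \<longleftrightarrow> ?iii)")
proof -
  interpret sigma_finite_measure M by fact
  \<comment> \<open>Sigma-finiteness provides the strictly positive integrable weight on which both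
    implications into (ii) rest.\<close>
  obtain w :: "'a \<Rightarrow> real" where w: "w \<in> borel_measurable M" "\<And>x. 0 < w x" "integrable M w"
    using obtain_positive_integrable_function by metis
  interpret positive_weight M w
    by unfold_locales (use w in auto)
  have "?i \<Longrightarrow> ?ii"
    using factorization_of_separating[OF assms(2,3)] by blast
  moreover have "?ii \<Longrightarrow> ?i"
  proof -
    assume ?ii
    then obtain c \<alpha> \<beta> where u: "unitary_fn M \<alpha>" "unitary_fn M \<beta>"
      and eq: "AE z in M \<Otimes>\<^sub>M M. \<phi> z = c * \<alpha> (fst z) * \<beta> (snd z)" by blast
    \<comment> \<open>The witness for \<open>E\<close> is the two-sided multiplication of (iii),
      which acts on every operator.\<close>
    have "schur_bounded_ext M p \<phi> (mult_conj c \<alpha> \<beta>)"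
      by (rule schur_bounded_ext_mult_conj[OF assms(2) _ u eq]) (use assms(4) in simp)
    moreover have "separating M p (mult_conj c \<alpha> \<beta>)"
      unfolding separating_def in_schatten_def using op_disjoint_mult_conj[OF u] by blast
    ultimately show ?i by blast
  qed
  moreover have "?ii \<Longrightarrow> ?iii"
  proof -
    assume ?ii
    then obtain c \<alpha> \<beta> where u: "unitary_fn M \<alpha>" "unitary_fn M \<beta>"
      and eq: "AE z in M \<Otimes>\<^sub>M M. \<phi> z = c * \<alpha> (fst z) * \<beta> (snd z)" by blast
    have "op_eq M (kernel_op M (\<lambda>z. \<phi> z * f z)) (\<lambda>h s. c * \<alpha> s * kernel_op M f (\<lambda>t. \<beta> t * h t) s)"
      if "f \<in> L2 (M \<Otimes>\<^sub>M M)" for f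
      using kernel_op_factorized[OF assms(2) L2_measurable[OF that] _ _ eq] u
      by (simp add: unitary_fn_def mult_conj_def)
    with u show ?iii by blast
  qed
  moreover have "?iii \<Longrightarrow> ?ii"
    using factorization_of_mult_conj[OF assms(2,3)] unfolding mult_conj_def by blast
  ultimately show ?thesis by blast
qed

end
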